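(* Let $E\subset\mathbb{R}^2$ be a bounded $BV$-extension set (where $\mathbb{R}^2$ carries the Euclidean distance and the Lebesgue measure). Let $\{\Omega_i\}_{i\in I}$ be the connected components of $\mathbb{R}^2\setminus\overline{E^1}$. Then $\partial\Omega_i\cap\partial\Omega_j$ is finite for every $i\ne j$.
   Context: $E^1:=\{x\in\mathbb{R}^2: \liminf_{r\to0}\mathcal{L}^2(B(x,r)\cap E)/\mathcal{L}^2(B(x,r))=1\}$ is the set of density-one points of $E$, and $\overline{E^1}$ its closure. $BV$. Let $(X,d,m)$ be a metric measure space ($(X,d)$ complete separable, $m$ nonnegative Borel, finite on bounded sets); here $X=\mathbb{R}^2$, $d$ Euclidean, $m=\mathcal{L}^2$. Set $\mathrm{lip}\,u(x)=\limsup_{y\to x}|u(y)-u(x)|/d(x,y)$ if $x$ is an accumulation point, $0$ otherwise. For $u\in L^1_{loc}(X)$ and $A$ open, $|Du|(A):=\inf\{\liminf_n\int_A \mathrm{lip}\,u_n\,dm : u_n\in \mathrm{Lip}_{loc}(A),\ u_n\to u \text{ in } L^1_{loc}(m|_A)\}$ ($\mathrm{Lip}_{loc}$: locally Lipschitz); for $B$ Borel, $|Du|(B):=\inf\{|Du|(A): A\supset B \text{ open}\}$. For $B$ Borel and $u\in L^1_{loc}(m|_B)$, $|Du|_B$ is the total variation of $u$ computed in $(X,d,m|_B)$. $BV(B):=\{u\in L^1(m|_B): |Du|_B(B)<\infty\}$ with norm $\|u\|_{BV(B)}=\|u\|_{L^1(m|_B)}+|Du|_B(B)$. A Borel set $E$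 is a $BV$-extension set if there exist $C\ge1$ and a (not necessarily linear) map $T\colon BV(E)\to BV(X)$ with $Tu=u$ ($m$-a.e.) on $E$ and $\|Tu\|_{BV(X)}\le C\|u\|_{BV(E)}$ for every $u\in BV(E)$. *)

theory Defs
  imports "HOL-Analysis.Analysis"
begin

text \<open>
  A metric measure space is a metric space type together with a measure \<open>M\<close> with
  \<^term>\<open>sets M = sets borel\<close>; the theorem uses \<^term>\<open>lborel\<close> on \<^typ>\<open>real ^ 2\<close>.
  Functions on a subset of the space are total functions, of which only the values on that
  subset matter.  The restriction of \<open>M\<close> to \<open>B\<close> is again a measure on the whole space.
\<close>

definition restrict_measure :: "'a::metric_space measure \<Rightarrow> 'a set \<Rightarrow> 'a measure" where
  "restrict_measure M B = density M (indicator B)"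

definition slope :: "('a::metric_space \<Rightarrow> real) \<Rightarrow> 'a \<Rightarrow> ennreal" where
  "slope u x =
     (if x islimpt UNIV then Limsup (at x) (\<lambda>y. ennreal (\<bar>u y - u x\<bar> / dist y x)) else 0)"

definition locally_lipschitz_on :: "'a::metric_space set \<Rightarrow> ('a \<Rightarrow> real) \<Rightarrow> bool" where
  "locally_lipschitz_on A u \<longleftrightarrow> (\<forall>x\<in>A. \<exists>r>0. \<exists>L. L-lipschitz_on (ball x r \<inter> A) u)"

text \<open>
  Convergence in \<open>L\<^sup>1\<^sub>l\<^sub>o\<^sub>c\<close> of \<open>A\<close>: every point of \<open>A\<close> has a neighbourhood in \<open>A\<close>
  on which the sequence converges in \<open>L\<^sup>1\<close>.
\<close>

definition L1loc_tendsto ::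
  "'a::metric_space measure \<Rightarrow> 'a set \<Rightarrow> (nat \<Rightarrow> 'a \<Rightarrow> real) \<Rightarrow> ('a \<Rightarrow> real) \<Rightarrow> bool" where
  "L1loc_tendsto M A v u \<longleftrightarrow>
     (\<forall>x\<in>A. \<exists>r>0.
        (\<lambda>n. \<integral>\<^sup>+y\<in>ball x r \<inter> A. ennreal \<bar>v n y - u y\<bar> \<partial>M) \<longlonglongrightarrow> 0)"

definition total_variation_open ::
  "'a::metric_space measure \<Rightarrow> ('a \<Rightarrow> real) \<Rightarrow> 'a set \<Rightarrow> ennreal" where
  "total_variation_open M u A =
     Inf {liminf (\<lambda>n. \<integral>\<^sup>+x\<in>A. slope (v n) x \<partial>M) | v.
            (\<forall>n. locally_lipschitz_on A (v n)) \<and> L1loc_tendsto M A v u}"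

definition total_variation ::
  "'a::metric_space measure \<Rightarrow> ('a \<Rightarrow> real) \<Rightarrow> 'a set \<Rightarrow> ennreal" where
  "total_variation M u B = Inf {total_variation_open M u A | A. open A \<and> B \<subseteq> A}"

text \<open>
  Membership in \<open>BV(B)\<close> is a property of Borel representatives; elements of \<open>BV(B)\<close> in the
  usual sense are their classes modulo equality \<open>M\<close>-a.e. on \<open>B\<close>.
\<close>

definition BV :: "'a::metric_space measure \<Rightarrow> 'a set \<Rightarrow> ('a \<Rightarrow> real) set" where
  "BV M B = {u. integrable (restrict_measure M B) u \<and>
                total_variation (restrict_measure M B) u B < \<infinity>}"

definition BV_norm :: "'a::metric_space measure \<Rightarrow> 'a set \<Rightarrow> ('a \<Rightarrow> real) \<Rightarrow> ennreal" where
  "BV_norm M B u =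
     (\<integral>\<^sup>+x. ennreal \<bar>u x\<bar> \<partial>restrict_measure M B) + total_variation (restrict_measure M B) u B"

text \<open>
  The second conjunct under the existential quantifier says that \<open>T\<close> is well defined on
  a.e.-equivalence classes.
\<close>

definition BV_extension_set :: "'a::metric_space measure \<Rightarrow> 'a set \<Rightarrow> bool" where
  "BV_extension_set M E \<longleftrightarrow>
     E \<in> sets borel \<and>
     (\<exists>(C::real) T. C \<ge> 1 \<and>
        (\<forall>u\<in>BV M E. \<forall>v\<in>BV M E.
           (AE x in M. x \<in> E \<longrightarrow> u x = v x) \<longrightarrow> (AE x in M. T u x = T v x)) \<and>
        (\<forall>u\<in>BV M E.
           T u \<in> BV M UNIV \<and>
           (AE x in M. x \<in> E \<longrightarrow> T u x = u x) \<and>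
           BV_norm M UNIV (T u) \<le> ennreal C * BV_norm M E u))"

definition density_one_points :: "(real ^ 2) set \<Rightarrow> (real ^ 2) set" where
  "density_one_points E =
     {x. Liminf (at_right 0)
           (\<lambda>r. emeasure lborel (ball x r \<inter> E) / emeasure lborel (ball x r)) = 1}"

end

theory Submission imports Defs begin

text \<open>
  Let \<open>F\<close> be the closure of the set of density-one points of \<open>E\<close>. Almost all of \<open>E\<close> lies in
  \<open>F\<close>, and every ball about a point of \<open>F\<close> meets \<open>E\<close> in positive measure. Suppose that two
  components \<open>A\<close> and \<open>B\<close> of the complement of \<open>F\<close> have infinitely many common boundary
  points, let \<open>X\<close> consist of \<open>N\<close> of them, and choose \<open>\<sigma>\<close> so that the discs of radius \<open>\<sigma>\<close>
  about the points of \<open>X\<close> are disjoint.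

  Remove the discs of radius \<open>\<rho> \<le> \<sigma>\<close> about \<open>X\<close> from \<open>F\<close>. However small \<open>\<rho>\<close> is,
  the rest splits into relatively clopen pieces of which at least \<open>N\<close> have a point outside the
  discs of radius \<open>\<sigma>\<close> (\<open>common_boundary_points_split\<close>). To see this, fix \<open>x0\<close> in \<open>X\<close>. Both
  \<open>A\<close> and \<open>B\<close> stay connected when the small discs are added to them, so each
  \<open>(z - a) / (z - x0)\<close> has a continuous logarithm off \<open>A\<close> and the discs, and another one off \<open>B\<close>
  and the discs. On the rest of \<open>F\<close> the two differ by \<open>2 \<pi> \<i>\<close> times a locally constant integer,
  and these integers label the pieces. With fewer than \<open>N\<close> labels outside the large discs, an
  integer relation between them would allow the logarithms of some product of powers of the
  quotients to be glued along \<open>F\<close> to one on the complement of the large discs, which is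
  impossible on a circle about one of the \<open>a\<close>. Discs are removed and not points because a point
  of \<open>X\<close> may be inaccessible from \<open>A\<close> or from \<open>B\<close>; removing the points alone might then leave
  the rest of \<open>F\<close> connected.

  Extending functions from \<open>E\<close> bounds the mass of these pieces from below. Let \<open>C\<close> be the
  constant of the extension operator \<open>T\<close>. Translation by \<open>h\<close> changes \<open>T u\<close> in \<open>L\<^sup>1\<close> by at most \<open>\<bar>h\<bar>\<close> times its total variation, and an average of \<open>T u\<close> over a
  disc of radius \<open>R\<close> is at most the \<open>L\<^sup>1\<close> norm divided by \<open>\<pi> R\<^sup>2\<close>. Hence, if \<open>u = 1\<close> on
  \<open>Q \<subseteq> E\<close> and \<open>n\<close> bounds the norm of \<open>u\<close> in \<open>BV(E)\<close>, then
  \<open>\<pi> R\<^sup>2 \<bar>Q\<bar> \<le> \<pi> R\<^sup>2 R C n + \<bar>Q\<bar> C n\<close> (\<open>BV_extension_mass_bound\<close>). This is applied to a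
  cut-off function times the indicator of a piece \<open>U\<close>; as \<open>U\<close> is at positive distance from the
  other pieces, only the cut-off contributes to the variation (\<open>BV_norm_separated_cutoff\<close>).
  Cut-offs at shrinking radii about a point of \<open>U\<close> far from \<open>X\<close> give a lower bound for the
  measure of \<open>E \<inter> U\<close> that depends on \<open>\<sigma>\<close> and not on \<open>\<rho>\<close> (\<open>local_mass_lower_bound\<close>). A cut-off
  that vanishes near \<open>X\<close> has variation of order \<open>N \<rho>\<close>, which is negligible against that bound
  when \<open>\<rho>\<close> is small, and then the inequality yields a lower bound that depends on \<open>C\<close> only
  (\<open>piece_mass_lower_bound\<close>). As the pieces are disjoint, this bounds \<open>N\<close>.
\<close>

section \<open>Points of density one\<close>

text \<open>
  Balls in which \<open>E\<close> fills less than the fraction \<open>c\<close> cover the set in the sense of Vitali. A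
  disjoint family of them inside an open \<open>U\<close> shows that the set is contained, up to a null set, in
  a set of measure at most \<open>c \<bar>U\<bar>\<close>. Hence its outer measure, the infimum over all such \<open>U\<close>, is at
  most \<open>c\<close> times itself.
\<close>

lemma negligible_low_density_points:
  fixes E :: "'a::euclidean_space set"
  assumes E: "E \<in> sets borel" "bounded E" and c: "0 \<le> c" "c < 1"
  shows "negligible {x \<in> E. \<forall>e>0. \<exists>r. 0 < r \<and> r < e \<and>
           emeasure lborel (ball x r \<inter> E) < ennreal c * emeasure lborel (ball x r)}"
    (is "negligible {x \<in> E. \<forall>e>0. \<exists>r. 0 < r \<and> r < e \<and> ?low x r}")
proof -
  define A where "A = {x \<in> E. \<forall>e>0. \<exists>r. 0 < r \<and> r < e \<and> ?low x r}"
  have subE: "A \<subseteq> E" and low: "\<And>x e. x \<in> A \<Longrightarrow> 0 < e \<Longrightarrow> \<exists>r. 0 < r \<and> r < e \<and> ?low x r"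
    unfolding A_def by blast+
  \<comment> \<open>The infimum \<open>M\<close> is the outer measure of \<open>A\<close>.\<close>
  define \<U> where "\<U> = {U. open U \<and> A \<subseteq> U \<and> U \<in> lmeasurable}"
  define M where "M = Inf (measure lebesgue ` \<U>)"
  have bdd: "bdd_below (measure lebesgue ` \<U>)" by (auto intro!: bdd_belowI[of _ 0])
  obtain R where "E \<subseteq> ball 0 R"
    using E(2) bounded_subset_ballD by blast
  then have "A \<subseteq> ball 0 R" using subE by auto
  then have ne: "\<U> \<noteq> {}" by (auto simp: \<U>_def intro!: exI[of _ "ball 0 R"])
  have step: "M \<le> c * measure lebesgue U + e" if U: "U \<in> \<U>" and e: "e > 0" for U e
  proof -
    define K where "K = {(x, r). x \<in> A \<and> 0 < r \<and> ball x r \<subseteq> U \<and>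
      emeasure lborel (ball x r \<inter> E) < ennreal c * emeasure lborel (ball x r)}"
    have "\<exists>i. i \<in> K \<and> x \<in> ball (fst i) (snd i) \<and> snd i < d" if x: "x \<in> A" and d: "d > 0" for x d
    proof -
      obtain d' where "d' > 0" "ball x d' \<subseteq> U"
        using U x openE[of U x] unfolding \<U>_def by blast
      moreover obtain r where "0 < r" "r < min d d'"
        "emeasure lborel (ball x r \<inter> E) < ennreal c * emeasure lborel (ball x r)"
        using low[OF x, of "min d d'"] \<open>d' > 0\<close> d by auto
      moreover have "ball x r \<subseteq> ball x d'" using \<open>r < min d d'\<close> by auto
      ultimately show ?thesis using x by (intro exI[of _ "(x, r)"]) (auto simp: K_def)
    qed
    then obtain C where C: "countable C" "C \<subseteq> K"
      "pairwise (\<lambda>i j. disjnt (ball (fst i) (snd i)) (ball (fst j) (snd j))) C"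
      "negligible (A - (\<Union>i\<in>C. ball (fst i) (snd i)))"
      using Vitali_covering_theorem_balls[of A K fst snd] by blast
    let ?B = "\<lambda>i::'a \<times> real. ball (fst i) (snd i)"
    have disj: "disjoint_family_on ?B C"
      using C(3) by (auto simp: disjoint_family_on_def pairwise_def disjnt_def simp del: split_paired_All)
    then have disjE: "disjoint_family_on (\<lambda>i. ?B i \<inter> E) C"
      unfolding disjoint_family_on_def by blast
    define W where "W = (\<Union>i\<in>C. ?B i \<inter> E)"
    have W: "W \<in> sets lborel" unfolding W_def sets_lborel using E(1) by (intro sets.countable_UN''[OF C(1)]) auto
    have "emeasure lborel W = (\<integral>\<^sup>+i. emeasure lborel (?B i \<inter> E) \<partial>count_space C)"
      unfolding W_def using E(1) by (intro emeasure_UN_countable C(1) disjE) auto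
    also have "\<dots> \<le> (\<integral>\<^sup>+i. ennreal c * emeasure lborel (?B i) \<partial>count_space C)"
      using C(2) by (intro nn_integral_mono) (auto simp: K_def)
    also have "\<dots> = ennreal c * (\<integral>\<^sup>+i. emeasure lborel (?B i) \<partial>count_space C)"
      by (simp add: nn_integral_cmult)
    also have "(\<integral>\<^sup>+i. emeasure lborel (?B i) \<partial>count_space C) = emeasure lborel (\<Union>i\<in>C. ?B i)"
      by (intro emeasure_UN_countable[symmetric] C(1) disj) auto
    also have "\<dots> \<le> emeasure lborel U"
    proof (intro emeasure_mono)
      show "(\<Union>i\<in>C. ?B i) \<subseteq> U" using C(2) unfolding K_def by fastforce
    qed (use U in \<open>auto simp: \<U>_def\<close>)
    also have "emeasure lborel U = ennreal (measure lebesgue U)"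
      using U emeasure_eq_measure2[of U lebesgue] by (simp add: \<U>_def)
    finally have mW: "emeasure lborel W \<le> ennreal (c * measure lebesgue U)"
      using c by (simp add: ennreal_mult mult_left_mono)
    have lW: "W \<in> lmeasurable"
      using W mW by (auto simp: fmeasurable_def intro: le_less_trans)
    have mW': "measure lebesgue W \<le> c * measure lebesgue U"
    proof -
      have "ennreal (measure lebesgue W) = emeasure lborel W"
        using emeasure_eq_measure2[OF lW] W by simp
      with mW have "ennreal (measure lebesgue W) \<le> ennreal (c * measure lebesgue U)" by simp
      then show ?thesis using c by (subst (asm) ennreal_le_iff) auto
    qed
    let ?N = "A - (\<Union>i\<in>C. ?B i)"
    have lNW: "?N \<union> W \<in> lmeasurable" using C(4) lW by (simp add: negligible_imp_measurable fmeasurable.Un)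
    obtain T where T: "open T" "?N \<union> W \<subseteq> T" "T - (?N \<union> W) \<in> lmeasurable"
      "measure lebesgue (T - (?N \<union> W)) < e"
    proof -
      obtain T where T: "open T" "?N \<union> W \<subseteq> T" "T - (?N \<union> W) \<in> lmeasurable"
        "emeasure lebesgue (T - (?N \<union> W)) < ennreal e"
        by (rule sets_lebesgue_outer_open[OF fmeasurableD[OF lNW] e])
      have "measure lebesgue (T - (?N \<union> W)) < e"
        using T(4) unfolding emeasure_eq_measure2[OF T(3)] by (subst (asm) ennreal_less_iff) auto
      with T that show thesis by blast
    qed
    have TT: "T = ?N \<union> W \<union> (T - (?N \<union> W))" using T(2) by blast
    have lT: "T \<in> lmeasurable" using fmeasurable.Un[OF lNW T(3)] TT by simp
    have "A \<subseteq> ?N \<union> W" unfolding W_def using subE by auto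
    then have "T \<in> \<U>" using T lT by (auto simp: \<U>_def)
    then have "M \<le> measure lebesgue T" unfolding M_def using bdd by (intro cInf_lower) auto
    also have "\<dots> \<le> measure lebesgue (?N \<union> W) + measure lebesgue (T - (?N \<union> W))"
      using measure_Un_le[of "?N \<union> W" lebesgue "T - (?N \<union> W)"] TT lNW T(3) by auto
    also have "measure lebesgue (?N \<union> W) \<le> measure lebesgue ?N + measure lebesgue W"
      using C(4) lW by (intro measure_Un_le) (auto simp: negligible_imp_sets)
    also have "measure lebesgue ?N = 0" using C(4) by (simp add: negligible_imp_measure0)
    finally show ?thesis using mW' T(4) by linarith
  qed
  have M0: "M \<ge> 0" unfolding M_def using ne by (intro cInf_greatest) auto
  have "M \<le> c * M"
  proof (rule field_le_epsilon)
    fix e :: real assume e: "e > 0"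
    obtain U where U: "U \<in> \<U>" "measure lebesgue U < M + e / 2"
      using cInf_lessD[of "measure lebesgue ` \<U>" "M + e / 2"] ne e unfolding M_def by auto
    have "M \<le> c * measure lebesgue U + e / 2" using step[OF U(1)] e by simp
    also have "c * measure lebesgue U \<le> c * (M + e / 2)" using U(2) c by (intro mult_left_mono) auto
    also have "c * (M + e / 2) \<le> c * M + e / 2" using c e by (simp add: distrib_left mult_left_le_one_le)
    finally show "M \<le> c * M + e" by simp
  qed
  then have "(1 - c) * M \<le> 0" by (simp add: algebra_simps)
  then have "M = 0" using M0 c by (simp add: mult_le_0_iff)
  show ?thesis
    unfolding A_def[symmetric] negligible_outer_le
  proof (intro allI impI)
    fix e :: real assume "e > 0"
    then obtain U where "U \<in> \<U>" "measure lebesgue U < e"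
      using cInf_lessD[of "measure lebesgue ` \<U>" e] ne \<open>M = 0\<close> unfolding M_def by auto
    then show "\<exists>T. A \<subseteq> T \<and> T \<in> lmeasurable \<and> measure lebesgue T \<le> e"
      by (intro exI[of _ U]) (auto simp: \<U>_def)
  qed
qed

lemma emeasure_ball_positive_finite:
  fixes x :: "'a::euclidean_space"
  assumes "r > 0"
  shows "0 < emeasure lborel (ball x r)" "emeasure lborel (ball x r) < \<infinity>"
  using assms by (auto simp: emeasure_ball ennreal_zero_less_mult_iff ennreal_mult_less_top unit_ball_vol_pos)

lemma AE_density_one_points:
  fixes E :: "(real ^ 2) set"
  assumes E: "E \<in> sets borel" "bounded E"
  shows "AE x in lborel. x \<in> E \<longrightarrow> x \<in> density_one_points E"
proof -
  define A where "A k = {x \<in> E. \<forall>e>0. \<exists>r. 0 < r \<and> r < e \<and>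
    emeasure lborel (ball x r \<inter> E) < ennreal (1 - 1 / real (Suc k)) * emeasure lborel (ball x r)}" for k
  have "negligible (A k)" for k
    unfolding A_def by (rule negligible_low_density_points[OF E]) auto
  then have "negligible (\<Union>k. A k)"
    by (intro negligible_countable_Union) auto
  then have "AE x in lborel. x \<notin> (\<Union>k. A k)"
    unfolding negligible_iff_null_sets using AE_not_in AE_completion_iff by blast
  then show ?thesis
  proof (eventually_elim, intro impI)
    fix x assume x: "x \<notin> (\<Union>k. A k)" "x \<in> E"
    let ?q = "\<lambda>r. emeasure lborel (ball x r \<inter> E) / emeasure lborel (ball x r)"
    have ge: "ennreal (1 - 1 / real (Suc k)) \<le> Liminf (at_right 0) ?q" for k
    proof (rule Liminf_bounded)
      obtain e where e: "e > 0" "\<And>r. 0 < r \<Longrightarrow> r < e \<Longrightarrow>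
        ennreal (1 - 1 / real (Suc k)) * emeasure lborel (ball x r) \<le> emeasure lborel (ball x r \<inter> E)"
        using x unfolding A_def by (simp del: of_nat_Suc) (metis not_less)
      have ev: "ennreal (1 - 1 / real (Suc k)) \<le> ?q r" if "0 < r" "r < e" for r
        using e(2)[OF that] emeasure_ball_positive_finite[OF that(1), of x]
        by (simp add: not_less[symmetric] divide_less_ennreal del: of_nat_Suc)
      then show "\<forall>\<^sub>F r in at_right 0. ennreal (1 - 1 / real (Suc k)) \<le> ?q r"
        unfolding eventually_at_right_field using e(1) ev by blast
    qed
    have "(\<lambda>k. 1 - 1 / real (Suc k)) \<longlonglongrightarrow> 1 - 0"
      by (intro tendsto_intros LIMSEQ_Suc lim_1_over_n)
    then have "(\<lambda>k. ennreal (1 - 1 / real (Suc k))) \<longlonglongrightarrow> ennreal 1"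
      by (intro tendsto_ennrealI) simp
    then have "1 \<le> Liminf (at_right 0) ?q"
      unfolding ennreal_1 by (rule LIMSEQ_le_const2) (use ge in blast)
    moreover have "Liminf (at_right 0) ?q \<le> 1"
    proof (rule Liminf_le)
      have "?q r \<le> 1" for r
      proof (cases "r > 0")
        case True
        then show ?thesis
          using emeasure_ball_positive_finite(1)[of r x]
          by (intro divide_le_posI_ennreal) (auto intro: emeasure_mono)
      next
        case False
        then have "ball x r = {}" by simp
        show ?thesis unfolding \<open>ball x r = {}\<close> by simp
      qed
      then show "\<forall>\<^sub>F r in at_right 0. ?q r \<le> 1" by simp
    qed simp
    ultimately show "x \<in> density_one_points E"
      by (auto simp: density_one_points_def)
  qed
qed

text \<open>
  This is how density one enters the lower bounds for the mass of a piece.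
\<close>

lemma density_one_point_emeasure_pos:
  assumes "y \<in> density_one_points E" "E \<in> sets borel" "r > 0"
  shows "emeasure lborel (ball y r \<inter> E) > 0"
proof -
  let ?q = "\<lambda>r. emeasure lborel (ball y r \<inter> E) / emeasure lborel (ball y r)"
  have "0 < Liminf (at_right 0) ?q" using assms(1) by (simp add: density_one_points_def)
  then have "\<forall>\<^sub>F r in at_right 0. 0 < ?q r" by (rule less_LiminfD)
  then obtain b where b: "b > 0" "\<And>s. 0 < s \<Longrightarrow> s < b \<Longrightarrow> 0 < ?q s"
    unfolding eventually_at_right_field by auto
  define s where "s = min b r / 2"
  have s: "0 < s" "s < b" "s < r" using b(1) assms(3) by (auto simp: s_def)
  have "0 < ?q s" using b(2) s by blast
  then have "0 < emeasure lborel (ball y s \<inter> E)"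
    by (metis ennreal_zero_divide not_gr_zero)
  also have "\<dots> \<le> emeasure lborel (ball y r \<inter> E)"
    using s assms(2) by (intro emeasure_mono) auto
  finally show ?thesis .
qed

lemma density_one_points_subset_closure:
  assumes "E \<in> sets borel"
  shows "density_one_points E \<subseteq> closure E"
proof
  fix y assume y: "y \<in> density_one_points E"
  have "ball y r \<inter> E \<noteq> {}" if "r > 0" for r
    using density_one_point_emeasure_pos[OF y assms that] by auto
  then show "y \<in> closure E"
    unfolding closure_approachable by (metis disjoint_iff dist_commute mem_ball)
qed

section \<open>Translations and total variation\<close>

lemma locally_lipschitz_imp_lipschitz_on_compact:
  assumes "locally_lipschitz_on UNIV v" "compact K"
  obtains L where "L-lipschitz_on K v"
proof -
  have "local_lipschitz {0::real} K (\<lambda>_. v)"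
  proof (rule local_lipschitzI)
    fix t x assume "t \<in> {0::real}" "x \<in> K"
    obtain r L where r: "r > 0" "L-lipschitz_on (ball x r \<inter> UNIV) v"
      using assms(1) unfolding locally_lipschitz_on_def by blast
    have "L-lipschitz_on (cball x (r/2) \<inter> K) v"
      by (rule lipschitz_on_subset[OF r(2)]) (use r(1) in auto)
    then show "\<exists>u>0. \<exists>L. \<forall>t\<in>cball t u \<inter> {0}. L-lipschitz_on (cball x u \<inter> K) v"
      using r(1) by (intro exI[of _ "r/2"]) auto
  qed
  then obtain L where "\<And>t. t \<in> {0::real} \<Longrightarrow> L-lipschitz_on K v"
    using local_lipschitz_compact_implies_lipschitz[of "{0::real}" K "\<lambda>_. v"] assms(2) by auto
  then show thesis using that by blast
qed

lemma locally_lipschitz_on_continuous: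
  assumes "locally_lipschitz_on UNIV v"
  shows "continuous_on UNIV v"
proof (rule continuous_at_imp_continuous_on, rule ballI)
  fix x
  obtain r L where r: "r > 0" "L-lipschitz_on (ball x r \<inter> UNIV) v"
    using assms unfolding locally_lipschitz_on_def by blast
  then have "continuous_on (ball x r) v"
    using lipschitz_on_continuous_on by fastforce
  then show "isCont v x"
    using r(1) continuous_on_interior by (metis centre_in_ball interior_ball)
qed

lemma Limsup_filterlim_le:
  fixes q :: "'a \<Rightarrow> 'b::complete_linorder"
  assumes "filterlim y F G"
  shows "Limsup G (\<lambda>n. q (y n)) \<le> Limsup F q"
proof (unfold Limsup_le_iff, intro allI impI)
  fix z assume "Limsup F q < z"
  then have "\<forall>\<^sub>F x in F. q x < z" by (rule Limsup_lessD)
  then show "\<forall>\<^sub>F n in G. q (y n) < z"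
    using assms by (auto simp: filterlim_iff)
qed

lemma limsup_difference_quotient_le_slope:
  fixes h :: "'a::euclidean_space"
  assumes "h \<noteq> 0"
  shows "limsup (\<lambda>n. ennreal (\<bar>v (x + h /\<^sub>R real (Suc n)) - v x\<bar> / (norm h / real (Suc n)))) \<le> slope v x"
proof -
  have "(\<lambda>n. x + h /\<^sub>R real (Suc n)) \<longlonglongrightarrow> x + 0 *\<^sub>R h"
    by (intro tendsto_intros LIMSEQ_inverse_real_of_nat)
  then have "filterlim (\<lambda>n. x + h /\<^sub>R real (Suc n)) (at x) sequentially"
    using assms by (intro filterlim_atI) (auto simp del: of_nat_Suc)
  then have "limsup (\<lambda>n. ennreal (\<bar>v (x + h /\<^sub>R real (Suc n)) - v x\<bar> / dist (x + h /\<^sub>R real (Suc n)) x))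
    \<le> Limsup (at x) (\<lambda>y. ennreal (\<bar>v y - v x\<bar> / dist y x))"
    by (rule Limsup_filterlim_le)
  moreover have "dist (x + h /\<^sub>R real (Suc n)) x = norm h / real (Suc n)" for n
    by (simp add: dist_norm divide_inverse mult.commute del: of_nat_Suc)
  ultimately show ?thesis by (simp add: slope_def islimpt_UNIV del: of_nat_Suc)
qed

lemma nn_integral_lborel_shift:
  fixes f :: "'a::euclidean_space \<Rightarrow> ennreal"
  assumes [measurable]: "f \<in> borel_measurable borel"
  shows "(\<integral>\<^sup>+x. f (x + c) \<partial>lborel) = (\<integral>\<^sup>+x. f x \<partial>lborel)"
proof -
  have "(\<integral>\<^sup>+x. f x \<partial>lborel) = (\<integral>\<^sup>+x. f x \<partial>distr lborel borel ((+) c))"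
    by (simp add: lborel_distr_plus)
  also have "\<dots> = (\<integral>\<^sup>+x. f (c + x) \<partial>lborel)"
    by (rule nn_integral_distr) auto
  finally show ?thesis by (simp add: add.commute)
qed

text \<open>
  Divide the step \<open>h\<close> into \<open>N\<close> equal steps and translate each of the \<open>N\<close> integrals back to a common
  ball. This bounds the left-hand side by the integral of the difference quotient with step \<open>h / N\<close>.
  As \<open>N\<close> tends to infinity, the reverse Fatou lemma, with the local Lipschitz constant as dominating
  function, moves the upper limit inside the integral, where it is at most the slope. In this way
  the slope occurs only as a pointwise upper bound for a measurable integrand.
\<close>

lemma translation_quotient_le_slope_integral:
  fixes v :: "'a::euclidean_space \<Rightarrow> real"
  assumes v: "locally_lipschitz_on UNIV v" and h: "h \<noteq> 0"
  shows "(\<integral>\<^sup>+x\<in>cball 0 R. ennreal (\<bar>v (x + h) - v x\<bar> / norm h) \<partial>lborel) \<le> (\<integral>\<^sup>+x. slope v x \<partial>lborel)"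
proof -
  have cont: "continuous_on UNIV v" by (rule locally_lipschitz_on_continuous[OF v])
  then have [measurable]: "v \<in> borel_measurable borel" by (rule borel_measurable_continuous_onI)
  define q where "q n y = ennreal (\<bar>v (y + h /\<^sub>R real (Suc n)) - v y\<bar> / (norm h / real (Suc n)))" for n y
  have [measurable]: "q n \<in> borel_measurable borel" for n unfolding q_def by measurable
  let ?B = "cball (0::'a) (R + norm h)"
  let ?Y = "\<integral>\<^sup>+x\<in>cball 0 R. ennreal (\<bar>v (x + h) - v x\<bar> / norm h) \<partial>lborel"
  have le: "?Y \<le> (\<integral>\<^sup>+y. q n y * indicator ?B y \<partial>lborel)" for n
  proof -
    let ?N = "Suc n"
    define p where "p x k = x + (real k / real ?N) *\<^sub>R h" for x k
    have p_Suc: "p x (Suc k) = p x k + h /\<^sub>R real ?N" for x k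
      by (simp add: p_def add_divide_distrib algebra_simps divide_inverse)
    have pw: "ennreal (\<bar>v (x + h) - v x\<bar> / norm h) * indicator (cball 0 R) x
      \<le> (\<Sum>k<?N. ennreal (1 / real ?N) * (q n (p x k) * indicator ?B (p x k)))" for x
    proof (cases "x \<in> cball 0 R")
      case True
      have inB: "p x k \<in> ?B" if "k < ?N" for k
      proof -
        have "norm (p x k) \<le> norm x + (real k / real ?N) * norm h"
          unfolding p_def by (rule norm_triangle_le) simp
        also have "(real k / real ?N) * norm h \<le> 1 * norm h"
          using that by (intro mult_right_mono) auto
        finally show ?thesis using True by simp
      qed
      have "v (x + h) - v x = (\<Sum>k<?N. v (p x (Suc k)) - v (p x k))"
        by (subst sum_lessThan_telescope) (simp add: p_def del: of_nat_Suc)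
      then have "\<bar>v (x + h) - v x\<bar> \<le> (\<Sum>k<?N. \<bar>v (p x (Suc k)) - v (p x k)\<bar>)"
        by (simp only: sum_abs)
      then have "\<bar>v (x + h) - v x\<bar> / norm h \<le> (\<Sum>k<?N. \<bar>v (p x (Suc k)) - v (p x k)\<bar>) / norm h"
        by (rule divide_right_mono) simp
      also have "\<dots> = (\<Sum>k<?N. 1 / real ?N * (\<bar>v (p x k + h /\<^sub>R real ?N) - v (p x k)\<bar> / (norm h / real ?N)))"
        unfolding p_Suc sum_divide_distrib by (rule sum.cong) (auto simp del: of_nat_Suc)
      finally have "ennreal (\<bar>v (x + h) - v x\<bar> / norm h)
        \<le> ennreal (\<Sum>k<?N. 1 / real ?N * (\<bar>v (p x k + h /\<^sub>R real ?N) - v (p x k)\<bar> / (norm h / real ?N)))"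
        by (rule ennreal_leI)
      also have "\<dots> = (\<Sum>k<?N. ennreal (1 / real ?N) * q n (p x k))"
        unfolding q_def
        by (subst sum_ennreal[symmetric])
          (auto simp: ennreal_mult[symmetric] simp del: of_nat_Suc intro!: sum.cong)
      finally show ?thesis using True inB by simp
    qed auto
    define f where "f y = q n y * indicator ?B y" for y
    have [measurable]: "f \<in> borel_measurable borel" unfolding f_def
      by (intro borel_measurable_times_ennreal borel_measurable_indicator) auto
    have [measurable]: "(\<lambda>x. p x k) \<in> borel_measurable borel" for k unfolding p_def by measurable
    have shift: "(\<integral>\<^sup>+x. f (p x k) \<partial>lborel) = (\<integral>\<^sup>+x. f x \<partial>lborel)" for k
      unfolding p_def by (rule nn_integral_lborel_shift[of f]) (fact \<open>f \<in> borel_measurable borel\<close>)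
    have "?Y \<le> (\<integral>\<^sup>+x. (\<Sum>k<?N. ennreal (1 / real ?N) * f (p x k)) \<partial>lborel)"
      by (rule nn_integral_mono) (use pw in \<open>simp add: f_def del: of_nat_Suc sum.lessThan_Suc\<close>)
    also have "\<dots> = (\<Sum>k<?N. \<integral>\<^sup>+x. ennreal (1 / real ?N) * f (p x k) \<partial>lborel)"
      by (rule nn_integral_sum) measurable
    also have "\<dots> = (\<Sum>k<?N. ennreal (1 / real ?N) * (\<integral>\<^sup>+x. f x \<partial>lborel))"
      by (intro sum.cong refl) (simp add: nn_integral_cmult shift del: of_nat_Suc)
    also have "\<dots> = (of_nat ?N * ennreal (1 / real ?N)) * (\<integral>\<^sup>+x. f x \<partial>lborel)"
      by (simp add: mult.assoc del: of_nat_Suc sum.lessThan_Suc)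
    also have "of_nat ?N * ennreal (1 / real ?N) = 1"
      unfolding ennreal_of_nat_eq_real_of_nat by (subst ennreal_mult[symmetric]) auto
    finally show ?thesis by (simp add: f_def)
  qed
  obtain L where L: "L-lipschitz_on (cball 0 (R + norm h + norm h)) v"
    using locally_lipschitz_imp_lipschitz_on_compact[OF v compact_cball] by blast
  have "?Y \<le> limsup (\<lambda>n. \<integral>\<^sup>+y. q n y * indicator ?B y \<partial>lborel)"
    by (rule order_trans[OF _ Liminf_le_Limsup]) (auto intro!: Liminf_bounded le always_eventually)
  also have "\<dots> \<le> (\<integral>\<^sup>+y. limsup (\<lambda>n. q n y * indicator ?B y) \<partial>lborel)"
  proof (rule nn_integral_limsup)
    show "AE y in lborel. q n y * indicator ?B y \<le> ennreal L * indicator ?B y" for n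
    proof (intro AE_I2)
      fix y
      have "q n y \<le> ennreal L" if y: "y \<in> ?B"
      proof -
        have "norm (h /\<^sub>R real (Suc n)) \<le> norm h"
          using divide_left_mono[of 1 "real (Suc n)" "norm h"]
          by (simp add: divide_inverse mult.commute del: of_nat_Suc)
        then have "norm (y + h /\<^sub>R real (Suc n)) \<le> R + norm h + norm h"
          using y norm_triangle_ineq[of y "h /\<^sub>R real (Suc n)"] by auto
        moreover have "norm y \<le> R + norm h + norm h" using y by (auto intro: order_trans)
        ultimately have "dist (v (y + h /\<^sub>R real (Suc n))) (v y) \<le> L * dist (y + h /\<^sub>R real (Suc n)) y"
          by (intro lipschitz_onD[OF L]) auto
        then have "\<bar>v (y + h /\<^sub>R real (Suc n)) - v y\<bar> \<le> L * (norm h / real (Suc n))"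
          by (simp add: dist_norm divide_inverse mult_ac)
        then show ?thesis
          unfolding q_def using h by (intro ennreal_leI) (subst pos_divide_le_eq, auto simp del: of_nat_Suc)
      qed
      then show "q n y * indicator ?B y \<le> ennreal L * indicator ?B y"
        by (auto split: split_indicator)
    qed
    show "(\<integral>\<^sup>+y. ennreal L * indicator ?B y \<partial>lborel) < \<infinity>"
      using emeasure_lborel_cball_finite[of "0::'a" "R + norm h"]
      by (subst nn_integral_cmult_indicator) (auto simp: ennreal_mult_less_top)
  qed (auto intro!: borel_measurable_times_ennreal borel_measurable_indicator)
  also have "\<dots> \<le> (\<integral>\<^sup>+x. slope v x \<partial>lborel)"
  proof (rule nn_integral_mono)
    fix y
    have "limsup (\<lambda>n. q n y * indicator ?B y) \<le> limsup (\<lambda>n. q n y)"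
      by (intro Limsup_mono always_eventually) (auto split: split_indicator)
    also have "\<dots> \<le> slope v y"
      unfolding q_def by (rule limsup_difference_quotient_le_slope[OF h])
    finally show "limsup (\<lambda>n. q n y * indicator ?B y) \<le> slope v y" .
  qed
  finally show ?thesis .
qed

lemma L1loc_tendsto_compact:
  fixes w :: "'a::euclidean_space \<Rightarrow> real"
  assumes "L1loc_tendsto lborel UNIV v w" "compact K"
    and [measurable]: "\<And>n. v n \<in> borel_measurable borel" "w \<in> borel_measurable borel"
  shows "(\<lambda>n. \<integral>\<^sup>+y\<in>K. ennreal \<bar>v n y - w y\<bar> \<partial>lborel) \<longlonglongrightarrow> 0"
proof -
  have "\<forall>x. \<exists>r. r > 0 \<and>
      (\<lambda>n. \<integral>\<^sup>+y\<in>ball x r \<inter> UNIV. ennreal \<bar>v n y - w y\<bar> \<partial>lborel) \<longlonglongrightarrow> 0"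
    using assms(1) unfolding L1loc_tendsto_def by simp
  from choice[OF this] obtain r where r: "\<And>x. r x > 0"
    "\<And>x. (\<lambda>n. \<integral>\<^sup>+y\<in>ball x (r x) \<inter> UNIV. ennreal \<bar>v n y - w y\<bar> \<partial>lborel) \<longlonglongrightarrow> 0"
    by blast
  obtain D where D: "finite D" "K \<subseteq> (\<Union>x\<in>D. ball x (r x))"
  proof -
    have "K \<subseteq> (\<Union>x\<in>K. ball x (r x))" using r(1) centre_in_ball by blast
    with compactE_image[OF assms(2), of K "\<lambda>x. ball x (r x)"] show thesis
      using that by (metis open_ball)
  qed
  have le: "(\<integral>\<^sup>+y\<in>K. ennreal \<bar>v n y - w y\<bar> \<partial>lborel)
    \<le> (\<Sum>x\<in>D. \<integral>\<^sup>+y\<in>ball x (r x) \<inter> UNIV. ennreal \<bar>v n y - w y\<bar> \<partial>lborel)" for n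
  proof -
    have "ennreal \<bar>v n y - w y\<bar> * indicator K y
      \<le> (\<Sum>x\<in>D. ennreal \<bar>v n y - w y\<bar> * indicator (ball x (r x) \<inter> UNIV) y)" for y
    proof (cases "y \<in> K")
      case True
      then obtain x where x: "x \<in> D" "y \<in> ball x (r x)" using D(2) by blast
      then have "ennreal \<bar>v n y - w y\<bar> * indicator K y
        \<le> ennreal \<bar>v n y - w y\<bar> * indicator (ball x (r x) \<inter> UNIV) y" by (simp add: True)
      also have "\<dots> \<le> (\<Sum>x\<in>D. ennreal \<bar>v n y - w y\<bar> * indicator (ball x (r x) \<inter> UNIV) y)"
        using x(1) D(1) by (intro member_le_sum) auto
      finally show ?thesis .
    qed auto
    then have "(\<integral>\<^sup>+y\<in>K. ennreal \<bar>v n y - w y\<bar> \<partial>lborel)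
      \<le> (\<integral>\<^sup>+y. (\<Sum>x\<in>D. ennreal \<bar>v n y - w y\<bar> * indicator (ball x (r x) \<inter> UNIV) y) \<partial>lborel)"
      by (rule nn_integral_mono)
    also have "\<dots> = (\<Sum>x\<in>D. \<integral>\<^sup>+y\<in>ball x (r x) \<inter> UNIV. ennreal \<bar>v n y - w y\<bar> \<partial>lborel)"
      by (rule nn_integral_sum) (auto intro!: borel_measurable_times_ennreal borel_measurable_indicator)
    finally show ?thesis .
  qed
  have lim: "(\<lambda>n. \<Sum>x\<in>D. \<integral>\<^sup>+y\<in>ball x (r x) \<inter> UNIV. ennreal \<bar>v n y - w y\<bar> \<partial>lborel) \<longlonglongrightarrow> 0"
    using tendsto_sum[of D, OF r(2)] by simp
  show ?thesis
    by (rule tendsto_sandwich[OF _ always_eventually[OF allI[OF le]] tendsto_const lim]) simp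
qed

text \<open>
  The bound for locally Lipschitz functions survives approximation in \<open>L\<^sup>1\<^sub>l\<^sub>o\<^sub>c\<close>, because the
  left-hand side involves only a compact set.
\<close>

lemma translation_quotient_le_total_variation:
  fixes w :: "'a::euclidean_space \<Rightarrow> real"
  assumes [measurable]: "w \<in> borel_measurable borel" and h: "h \<noteq> 0"
  shows "(\<integral>\<^sup>+x\<in>cball 0 R. ennreal (\<bar>w (x + h) - w x\<bar> / norm h) \<partial>lborel)
    \<le> total_variation_open lborel w UNIV"
  unfolding total_variation_open_def
proof (rule Inf_greatest, clarify)
  fix v :: "nat \<Rightarrow> 'a \<Rightarrow> real"
  assume lip: "\<forall>n. locally_lipschitz_on UNIV (v n)" and L1: "L1loc_tendsto lborel UNIV v w"
  have [measurable]: "v n \<in> borel_measurable borel" for n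
    using lip locally_lipschitz_on_continuous borel_measurable_continuous_onI by blast
  let ?K = "cball (0::'a) (R + norm h)"
  let ?Y = "\<integral>\<^sup>+x\<in>cball 0 R. ennreal (\<bar>w (x + h) - w x\<bar> / norm h) \<partial>lborel"
  define a where "a n = (\<integral>\<^sup>+x\<in>UNIV. slope (v n) x \<partial>lborel)" for n
  define d where "d n y = ennreal \<bar>v n y - w y\<bar> * indicator ?K y" for n y
  have [measurable]: "d n \<in> borel_measurable borel" for n
    unfolding d_def by (intro borel_measurable_times_ennreal borel_measurable_indicator) auto
  define \<epsilon> where "\<epsilon> n = ennreal (2 / norm h) * (\<integral>\<^sup>+y. d n y \<partial>lborel)" for n
  have "(\<lambda>n. \<integral>\<^sup>+y. d n y \<partial>lborel) \<longlonglongrightarrow> 0"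
    unfolding d_def by (intro L1loc_tendsto_compact L1) auto
  then have "\<epsilon> \<longlonglongrightarrow> ennreal (2 / norm h) * 0"
    unfolding \<epsilon>_def by (intro ennreal_tendsto_cmult) auto
  then have \<epsilon>: "\<epsilon> \<longlonglongrightarrow> 0" by simp
  have le: "?Y \<le> a n + \<epsilon> n" for n
  proof -
    have pw: "ennreal (\<bar>w (x + h) - w x\<bar> / norm h) * indicator (cball 0 R) x
      \<le> ennreal (\<bar>v n (x + h) - v n x\<bar> / norm h) * indicator (cball 0 R) x
        + ennreal (1 / norm h) * (d n (x + h) + d n x)" for x
    proof (cases "x \<in> cball 0 R")
      case True
      then have "x + h \<in> ?K" "x \<in> ?K"
        using norm_triangle_ineq[of x h] by (auto intro: order_trans)
      then have d: "d n (x + h) = ennreal \<bar>v n (x + h) - w (x + h)\<bar>" "d n x = ennreal \<bar>v n x - w x\<bar>"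
        by (simp_all add: d_def)
      have "\<bar>w (x + h) - w x\<bar> \<le> \<bar>v n (x + h) - v n x\<bar> + (\<bar>v n (x + h) - w (x + h)\<bar> + \<bar>v n x - w x\<bar>)"
        by linarith
      then have "\<bar>w (x + h) - w x\<bar> / norm h
        \<le> (\<bar>v n (x + h) - v n x\<bar> + (\<bar>v n (x + h) - w (x + h)\<bar> + \<bar>v n x - w x\<bar>)) / norm h"
        by (rule divide_right_mono) simp
      also have "\<dots> = \<bar>v n (x + h) - v n x\<bar> / norm h
        + 1 / norm h * (\<bar>v n (x + h) - w (x + h)\<bar> + \<bar>v n x - w x\<bar>)"
        by (simp add: add_divide_distrib)
      finally have "ennreal (\<bar>w (x + h) - w x\<bar> / norm h) \<le> ennreal (\<bar>v n (x + h) - v n x\<bar> / norm h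
        + 1 / norm h * (\<bar>v n (x + h) - w (x + h)\<bar> + \<bar>v n x - w x\<bar>))"
        by (rule ennreal_leI)
      also have "\<dots> = ennreal (\<bar>v n (x + h) - v n x\<bar> / norm h) + ennreal (1 / norm h) * (d n (x + h) + d n x)"
        unfolding d
        by (subst ennreal_plus, simp, simp, subst ennreal_mult, simp, simp, subst ennreal_plus) auto
      finally show ?thesis using True by simp
    qed auto
    have "?Y \<le> (\<integral>\<^sup>+x. ennreal (\<bar>v n (x + h) - v n x\<bar> / norm h) * indicator (cball 0 R) x
        + ennreal (1 / norm h) * (d n (x + h) + d n x) \<partial>lborel)"
      by (intro nn_integral_mono pw)
    also have "\<dots> = (\<integral>\<^sup>+x\<in>cball 0 R. ennreal (\<bar>v n (x + h) - v n x\<bar> / norm h) \<partial>lborel)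
      + ennreal (1 / norm h) * ((\<integral>\<^sup>+x. d n (x + h) \<partial>lborel) + (\<integral>\<^sup>+x. d n x \<partial>lborel))"
    proof -
      have "(\<lambda>x. ennreal (\<bar>v n (x + h) - v n x\<bar> / norm h) * indicator (cball 0 R) x) \<in> borel_measurable lborel"
        by (intro borel_measurable_times_ennreal borel_measurable_indicator) auto
      then show ?thesis by (simp add: nn_integral_add nn_integral_cmult)
    qed
    also have "(\<integral>\<^sup>+x. d n (x + h) \<partial>lborel) = (\<integral>\<^sup>+x. d n x \<partial>lborel)"
      by (rule nn_integral_lborel_shift) measurable
    also have "ennreal (1 / norm h) * ((\<integral>\<^sup>+x. d n x \<partial>lborel) + (\<integral>\<^sup>+x. d n x \<partial>lborel)) = \<epsilon> n"
    proof -
      have "ennreal (2 / norm h) = ennreal (1 / norm h) * 2"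
        by (subst ennreal_numeral[symmetric], subst ennreal_mult[symmetric]) auto
      then show ?thesis by (simp add: \<epsilon>_def mult.assoc flip: mult_2)
    qed
    also have "(\<integral>\<^sup>+x\<in>cball 0 R. ennreal (\<bar>v n (x + h) - v n x\<bar> / norm h) \<partial>lborel) \<le> a n"
      unfolding a_def using translation_quotient_le_slope_integral[OF _ h] lip by simp
    finally show ?thesis by (simp add: add_right_mono)
  qed
  have eps: "?Y \<le> liminf a + ennreal e" if e: "e > 0" for e
  proof -
    have "\<forall>\<^sub>F n in sequentially. \<epsilon> n < ennreal e"
      using \<epsilon> by (rule order_tendstoD) (use e in auto)
    then have "\<forall>\<^sub>F n in sequentially. ?Y \<le> ennreal e + a n"
    proof eventually_elim
      case (elim n)
      have "a n + \<epsilon> n \<le> ennreal e + a n"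
        unfolding add.commute[of "ennreal e"] using elim by (intro add_left_mono less_imp_le)
      with le[of n] show ?case by (rule order_trans)
    qed
    then have "?Y \<le> liminf (\<lambda>n. ennreal e + a n)" by (rule Liminf_bounded)
    also have "\<dots> = ennreal e + liminf a" by (rule Liminf_const_add) simp
    finally show ?thesis by (simp add: add.commute)
  qed
  have "?Y \<le> liminf a" by (rule ennreal_le_epsilon) (rule eps)
  then show "?Y \<le> liminf (\<lambda>n. \<integral>\<^sup>+x\<in>UNIV. slope (v n) x \<partial>lborel)" by (simp add: a_def[abs_def])
qed

text \<open>
  Integrate \<open>\<bar>w x\<bar> \<le> \<bar>w (x + h) - w x\<bar> + \<bar>w (x + h)\<bar>\<close> over \<open>x\<close> in \<open>Q\<close> and \<open>h\<close> in the ball. The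
  first term is controlled by the variation. In the second, integration over \<open>h\<close> first gives at
  most the whole \<open>L\<^sup>1\<close> norm for each \<open>x\<close>. This takes the place of an isoperimetric inequality.
\<close>

lemma emeasure_ball_times_nn_integral_le:
  fixes w :: "'a::euclidean_space \<Rightarrow> real"
  assumes [measurable]: "w \<in> borel_measurable borel" "Q \<in> sets borel" and Q: "bounded Q" and R: "R > 0"
  shows "emeasure lborel (ball (0::'a) R) * (\<integral>\<^sup>+x\<in>Q. ennreal \<bar>w x\<bar> \<partial>lborel)
    \<le> emeasure lborel (ball (0::'a) R) * (ennreal R * total_variation_open lborel w UNIV)
      + emeasure lborel Q * (\<integral>\<^sup>+x. ennreal \<bar>w x\<bar> \<partial>lborel)"
proof -
  let ?B = "ball (0::'a) R" and ?\<tau> = "total_variation_open lborel w UNIV"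
  let ?I = "\<integral>\<^sup>+x. ennreal \<bar>w x\<bar> \<partial>lborel"
  obtain S where S: "Q \<subseteq> cball 0 S" using bounded_subset_ballD[OF Q] ball_subset_cball by blast
  define p where "p h x = ennreal \<bar>w (x + h)\<bar> * indicator Q x" for h x
  have trans: "(\<integral>\<^sup>+x\<in>Q. ennreal \<bar>w x\<bar> \<partial>lborel) \<le> ennreal R * ?\<tau> + (\<integral>\<^sup>+x. p h x \<partial>lborel)" if h: "h \<in> ?B" for h
  proof -
    have "(\<integral>\<^sup>+x\<in>Q. ennreal \<bar>w x\<bar> \<partial>lborel)
      \<le> (\<integral>\<^sup>+x. ennreal \<bar>w (x + h) - w x\<bar> * indicator Q x + p h x \<partial>lborel)"
    proof (rule nn_integral_mono)
      fix x
      have "ennreal \<bar>w x\<bar> \<le> ennreal (\<bar>w (x + h) - w x\<bar> + \<bar>w (x + h)\<bar>)"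
        by (intro ennreal_leI) linarith
      then show "ennreal \<bar>w x\<bar> * indicator Q x \<le> ennreal \<bar>w (x + h) - w x\<bar> * indicator Q x + p h x"
        by (auto simp: p_def split: split_indicator)
    qed
    also have "\<dots> = (\<integral>\<^sup>+x\<in>Q. ennreal \<bar>w (x + h) - w x\<bar> \<partial>lborel) + (\<integral>\<^sup>+x. p h x \<partial>lborel)"
      unfolding p_def by (intro nn_integral_add) auto
    also have "(\<integral>\<^sup>+x\<in>Q. ennreal \<bar>w (x + h) - w x\<bar> \<partial>lborel) \<le> ennreal R * ?\<tau>"
    proof (cases "h = 0")
      case False
      have meas: "(\<lambda>x. ennreal (\<bar>w (x + h) - w x\<bar> / norm h) * indicator (cball 0 S) x) \<in> borel_measurable lborel"
        by (intro borel_measurable_times_ennreal borel_measurable_indicator) auto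
      have "(\<integral>\<^sup>+x\<in>Q. ennreal \<bar>w (x + h) - w x\<bar> \<partial>lborel)
        \<le> (\<integral>\<^sup>+x. ennreal (norm h) * (ennreal (\<bar>w (x + h) - w x\<bar> / norm h) * indicator (cball 0 S) x) \<partial>lborel)"
      proof (rule nn_integral_mono)
        fix x
        have "ennreal \<bar>w (x + h) - w x\<bar> = ennreal (norm h) * ennreal (\<bar>w (x + h) - w x\<bar> / norm h)"
          using False by (subst ennreal_mult[symmetric]) auto
        then show "ennreal \<bar>w (x + h) - w x\<bar> * indicator Q x
          \<le> ennreal (norm h) * (ennreal (\<bar>w (x + h) - w x\<bar> / norm h) * indicator (cball 0 S) x)"
          using S by (auto split: split_indicator)
      qed
      also have "\<dots> = ennreal (norm h) * (\<integral>\<^sup>+x\<in>cball 0 S. ennreal (\<bar>w (x + h) - w x\<bar> / norm h) \<partial>lborel)"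
        by (rule nn_integral_cmult[OF meas])
      also have "\<dots> \<le> ennreal R * ?\<tau>"
        using h translation_quotient_le_total_variation[OF assms(1) False, of S]
        by (intro mult_mono) (auto intro: ennreal_leI)
      finally show ?thesis .
    qed simp
    finally show ?thesis by (simp add: add_right_mono)
  qed
  have p_meas[measurable]: "case_prod p \<in> borel_measurable (borel \<Otimes>\<^sub>M borel)"
    unfolding p_def by measurable
  have "emeasure lborel ?B * (\<integral>\<^sup>+x\<in>Q. ennreal \<bar>w x\<bar> \<partial>lborel)
    = (\<integral>\<^sup>+h. (\<integral>\<^sup>+x\<in>Q. ennreal \<bar>w x\<bar> \<partial>lborel) * indicator ?B h \<partial>lborel)"
    by (subst nn_integral_cmult_indicator) (auto simp: mult.commute)
  also have "\<dots> \<le> (\<integral>\<^sup>+h. (ennreal R * ?\<tau>) * indicator ?B h + (\<integral>\<^sup>+x. p h x \<partial>lborel) \<partial>lborel)"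
    using trans by (intro nn_integral_mono) (auto split: split_indicator)
  also have "\<dots> = (\<integral>\<^sup>+h. (ennreal R * ?\<tau>) * indicator ?B h \<partial>lborel) + (\<integral>\<^sup>+h. (\<integral>\<^sup>+x. p h x \<partial>lborel) \<partial>lborel)"
    by (intro nn_integral_add borel_measurable_times_ennreal borel_measurable_indicator) auto
  also have "(\<integral>\<^sup>+h. (ennreal R * ?\<tau>) * indicator ?B h \<partial>lborel) = emeasure lborel ?B * (ennreal R * ?\<tau>)"
    by (subst nn_integral_cmult_indicator) (auto simp: mult.commute)
  also have "(\<integral>\<^sup>+h. (\<integral>\<^sup>+x. p h x \<partial>lborel) \<partial>lborel) = (\<integral>\<^sup>+x. (\<integral>\<^sup>+h. p h x \<partial>lborel) \<partial>lborel)"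
    by (rule lborel_pair.Fubini'[symmetric]) simp
  also have "\<dots> = (\<integral>\<^sup>+x. ?I * indicator Q x \<partial>lborel)"
  proof (rule nn_integral_cong)
    fix x
    have "(\<integral>\<^sup>+h. p h x \<partial>lborel) = (\<integral>\<^sup>+h. ennreal \<bar>w (h + x)\<bar> \<partial>lborel) * indicator Q x"
      unfolding p_def by (subst nn_integral_multc) (auto simp: add.commute)
    also have "(\<integral>\<^sup>+h. ennreal \<bar>w (h + x)\<bar> \<partial>lborel) = ?I"
      using nn_integral_lborel_shift[of "\<lambda>y. ennreal \<bar>w y\<bar>" x] by simp
    finally show "(\<integral>\<^sup>+h. p h x \<partial>lborel) = ?I * indicator Q x" .
  qed
  also have "\<dots> = emeasure lborel Q * ?I"
    by (subst nn_integral_cmult_indicator) (auto simp: mult.commute)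
  finally show ?thesis .
qed

lemma restrict_measure_UNIV: "restrict_measure lborel UNIV = lborel"
  by (simp add: restrict_measure_def density_1)

lemma total_variation_UNIV: "total_variation M u UNIV = total_variation_open M u UNIV"
proof -
  have "{A::'a::metric_space set. open A \<and> UNIV \<subseteq> A} = {UNIV}" by auto
  then have "{total_variation_open M u A |A. open A \<and> UNIV \<subseteq> A} = {total_variation_open M u UNIV}"
    by (auto simp: top.extremum_unique)
  then show ?thesis by (simp add: total_variation_def)
qed

text \<open>
  The only consequence of the extension property that is used below. With \<open>R\<close> small against
  \<open>1 / C\<close> it prevents the norm \<open>n\<close> from being comparable to a small measure of \<open>Q\<close>.
\<close>

definition mass_bound :: "real \<Rightarrow> (real ^ 2) set \<Rightarrow> bool" where
  "mass_bound C E \<longleftrightarrow> (\<forall>u Q n R. u \<in> BV lborel E \<longrightarrow> Q \<in> sets borel \<longrightarrow> Q \<subseteq> E \<longrightarrow>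
     (\<forall>x\<in>Q. u x = 1) \<longrightarrow> BV_norm lborel E u \<le> ennreal n \<longrightarrow> 0 \<le> n \<longrightarrow> 0 < R \<longrightarrow>
     pi * R\<^sup>2 * measure lborel Q \<le> pi * R\<^sup>2 * (R * (C * n)) + measure lborel Q * (C * n))"

lemma BV_extension_mass_bound:
  fixes E :: "(real ^ 2) set"
  assumes "BV_extension_set lborel E" and bdd: "bounded E"
  obtains C where "C \<ge> 1" "mass_bound C E"
proof -
  from assms(1) obtain C T where C: "C \<ge> (1::real)" and
    "\<forall>u\<in>BV lborel E. T u \<in> BV lborel UNIV \<and> (AE x in lborel. x \<in> E \<longrightarrow> T u x = u x) \<and>
       BV_norm lborel UNIV (T u) \<le> ennreal C * BV_norm lborel E u"
    unfolding BV_extension_set_def by (elim conjE exE) (rule that; assumption)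
  then have T: "\<And>u. u \<in> BV lborel E \<Longrightarrow> T u \<in> BV lborel UNIV"
      "\<And>u. u \<in> BV lborel E \<Longrightarrow> AE x in lborel. x \<in> E \<longrightarrow> T u x = u x"
      "\<And>u. u \<in> BV lborel E \<Longrightarrow> BV_norm lborel UNIV (T u) \<le> ennreal C * BV_norm lborel E u"
    by simp_all
  show thesis
  proof (rule that[OF C], unfold mass_bound_def, intro allI impI)
    fix u Q and n R :: real
    assume u: "u \<in> BV lborel E" and Q[measurable]: "Q \<in> sets borel" "Q \<subseteq> E" and u1: "\<forall>x\<in>Q. u x = 1"
      and n: "BV_norm lborel E u \<le> ennreal n" "0 \<le> n" and R: "0 < R"
    define w where "w = T u"
    have w[measurable]: "w \<in> borel_measurable borel"
      using T(1)[OF u] unfolding BV_def restrict_measure_UNIV w_def by auto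
    have bQ: "bounded Q" using bdd Q(2) bounded_subset by blast
    have "BV_norm lborel UNIV w \<le> ennreal C * ennreal n"
      using T(3)[OF u] n(1) unfolding w_def by (meson mult_left_mono order_trans zero_le)
    then have "(\<integral>\<^sup>+x. ennreal \<bar>w x\<bar> \<partial>lborel) + total_variation_open lborel w UNIV \<le> ennreal (C * n)"
      using C n(2) by (simp add: BV_norm_def restrict_measure_UNIV total_variation_UNIV ennreal_mult)
    then have le: "(\<integral>\<^sup>+x. ennreal \<bar>w x\<bar> \<partial>lborel) \<le> ennreal (C * n)"
      "total_variation_open lborel w UNIV \<le> ennreal (C * n)"
      by (auto elim!: order_trans[rotated])
    have eQ: "emeasure lborel Q = ennreal (measure lborel Q)"
      using emeasure_bounded_finite[OF bQ] by (intro emeasure_eq_ennreal_measure) auto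
    have eB: "emeasure lborel (ball (0::real^2) R) = ennreal (pi * R\<^sup>2)"
      using R by (simp add: emeasure_ball unit_ball_vol_2)
    have "AE x in lborel. ennreal \<bar>w x\<bar> * indicator Q x = indicator Q x"
      using T(2)[OF u]
    proof eventually_elim
      case (elim x)
      then show ?case using u1 Q(2) by (auto simp: w_def split: split_indicator)
    qed
    then have "(\<integral>\<^sup>+x\<in>Q. ennreal \<bar>w x\<bar> \<partial>lborel) = (\<integral>\<^sup>+x. indicator Q x \<partial>lborel)"
      by (rule nn_integral_cong_AE)
    then have iQ: "(\<integral>\<^sup>+x\<in>Q. ennreal \<bar>w x\<bar> \<partial>lborel) = ennreal (measure lborel Q)"
      by (simp add: eQ)
    have "ennreal (pi * R\<^sup>2) * ennreal (measure lborel Q)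
      \<le> ennreal (pi * R\<^sup>2) * (ennreal R * total_variation_open lborel w UNIV)
        + ennreal (measure lborel Q) * (\<integral>\<^sup>+x. ennreal \<bar>w x\<bar> \<partial>lborel)"
      using emeasure_ball_times_nn_integral_le[OF w Q(1) bQ R] unfolding eB iQ eQ .
    also have "\<dots> \<le> ennreal (pi * R\<^sup>2) * (ennreal R * ennreal (C * n)) + ennreal (measure lborel Q) * ennreal (C * n)"
      using le by (intro add_mono mult_mono) auto
    finally show "pi * R\<^sup>2 * measure lborel Q \<le> pi * R\<^sup>2 * (R * (C * n)) + measure lborel Q * (C * n)"
      using R C n(2) by (simp flip: ennreal_mult ennreal_plus)
  qed
qed

section \<open>Cut-off functions on separated compact sets\<close>

lemma slope_cong:
  assumes "\<forall>\<^sub>F y in nhds x. f y = g y"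
  shows "slope f x = slope g x"
proof -
  have "f x = g x" using assms by (rule eventually_nhds_x_imp_x)
  moreover have "\<forall>\<^sub>F y in at x. f y = g y" using assms by (simp add: eventually_at_filter eventually_mono)
  ultimately have "Limsup (at x) (\<lambda>y. ennreal (\<bar>f y - f x\<bar> / dist y x))
    = Limsup (at x) (\<lambda>y. ennreal (\<bar>g y - g x\<bar> / dist y x))"
    by (intro Limsup_eq) (auto elim: eventually_mono)
  then show ?thesis by (simp add: slope_def)
qed

lemma slope_const [simp]: "slope (\<lambda>_. c) x = 0"
  by (auto simp: slope_def Limsup_const trivial_limit_within)

lemma slope_le_lipschitz_constant:
  assumes "L-lipschitz_on UNIV f"
  shows "slope f x \<le> ennreal L"
proof -
  have "ennreal (\<bar>f y - f x\<bar> / dist y x) \<le> ennreal L" for y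
    using lipschitz_onD[OF assms, of y x] lipschitz_on_nonneg[OF assms]
    by (intro ennreal_leI) (auto simp: dist_real_def divide_le_eq)
  then show ?thesis
    unfolding slope_def by (auto intro!: Limsup_bounded always_eventually)
qed

lemma AE_restrict_measure:
  assumes "E \<in> sets borel"
  shows "(AE x in restrict_measure lborel E. P x) \<longleftrightarrow> (AE x in lborel. x \<in> E \<longrightarrow> P x)"
  unfolding restrict_measure_def using assms
  by (subst AE_density) (auto simp: indicator_def)

lemma emeasure_restrict_measure:
  assumes [measurable]: "E \<in> sets borel" "A \<in> sets borel"
  shows "emeasure (restrict_measure lborel E) A = emeasure lborel (E \<inter> A)"
  unfolding restrict_measure_def using assms by (simp add: emeasure_density flip: indicator_inter_arith)

text \<open>
  The constant sequence \<open>v\<close> is admissible in the definition of the variation of \<open>u\<close>, on the whole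
  space.
\<close>

lemma total_variation_le_lipschitz:
  fixes u v :: "'a::euclidean_space \<Rightarrow> real"
  assumes "M-lipschitz_on UNIV v" and "AE x in \<mu>. v x = u x"
  shows "total_variation \<mu> u E \<le> (\<integral>\<^sup>+x. slope v x \<partial>\<mu>)"
proof -
  have "locally_lipschitz_on UNIV v"
    unfolding locally_lipschitz_on_def using assms(1) lipschitz_on_subset zero_less_one by blast
  moreover have "L1loc_tendsto \<mu> UNIV (\<lambda>_. v) u"
  proof -
    have "(\<integral>\<^sup>+y\<in>ball x 1 \<inter> UNIV. ennreal \<bar>v y - u y\<bar> \<partial>\<mu>) = (\<integral>\<^sup>+y. 0 \<partial>\<mu>)" for x
      by (rule nn_integral_cong_AE) (use assms(2) in \<open>auto elim: eventually_mono\<close>)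
    then show ?thesis unfolding L1loc_tendsto_def by (auto intro!: exI[of _ 1])
  qed
  ultimately have "total_variation_open \<mu> u UNIV \<le> liminf (\<lambda>n::nat. \<integral>\<^sup>+x\<in>UNIV. slope v x \<partial>\<mu>)"
    unfolding total_variation_open_def by (intro Inf_lower CollectI exI[of _ "\<lambda>_. v"]) auto
  then have "total_variation_open \<mu> u UNIV \<le> (\<integral>\<^sup>+x. slope v x \<partial>\<mu>)"
    by (simp add: Liminf_const)
  moreover have "total_variation \<mu> u E \<le> total_variation_open \<mu> u UNIV"
    unfolding total_variation_def by (intro Inf_lower) auto
  ultimately show ?thesis by (rule order_trans[rotated])
qed

text \<open>
  Take the minimum of \<open>\<psi>\<close> and a Lipschitz function that is at least \<open>1\<close> near \<open>U\<close> and vanishes near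
  \<open>V\<close>. On \<open>F\<close>, hence almost everywhere on \<open>E\<close>, it agrees with \<open>u\<close>, and near each point of \<open>F\<close> it
  is locally \<open>\<psi>\<close> or \<open>0\<close>. Its Lipschitz constant may be huge if \<open>U\<close> and \<open>V\<close> are close, but this
  constant is only felt off \<open>F\<close>.
\<close>

lemma BV_norm_separated_cutoff:
  fixes E F U V Z D P :: "'a::euclidean_space set" and \<psi> :: "'a \<Rightarrow> real"
  assumes E: "E \<in> sets borel" "bounded E" and EF: "AE x in lborel. x \<in> E \<longrightarrow> x \<in> F"
    and UV: "compact U" "compact V" "U \<inter> V = {}" "U \<noteq> {}"
    and F: "F \<subseteq> U \<union> V \<union> Z" and Z: "open Z" "\<And>x. x \<in> Z \<Longrightarrow> \<psi> x = 0"
    and \<psi>: "L-lipschitz_on UNIV \<psi>" "\<And>x. 0 \<le> \<psi> x" "\<And>x. \<psi> x \<le> 1"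
    and P: "P \<in> sets borel" "\<And>x. x \<notin> P \<Longrightarrow> \<psi> x = 0"
    and D: "D \<in> sets borel" "\<And>x. x \<notin> D \<Longrightarrow> slope \<psi> x = 0"
  defines "u \<equiv> \<lambda>x. indicator U x * \<psi> x"
  shows "u \<in> BV lborel E"
    and "BV_norm lborel E u \<le> ennreal (measure lborel (E \<inter> U \<inter> P) + L * measure lborel (E \<inter> U \<inter> D))"
proof -
  let ?\<mu> = "restrict_measure lborel E"
  have L0: "L \<ge> 0" using lipschitz_on_nonneg[OF \<psi>(1)] .
  obtain \<eta> where \<eta>: "\<eta> > 0" "\<And>x y. x \<in> U \<Longrightarrow> y \<in> V \<Longrightarrow> \<eta> \<le> dist x y"
    using separate_compact_closed[of U V] UV compact_imp_closed by metis
  \<comment> \<open>\<open>w\<close> is at least \<open>1\<close> near \<open>U\<close> and vanishes near \<open>V\<close>.\<close>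
  define w where "w x = max 0 (2 - 3 / \<eta> * infdist x U)" for x
  define v where "v x = min (\<psi> x) (w x)" for x
  have lip: "(L + 3 / \<eta>)-lipschitz_on UNIV v"
  proof (rule lipschitz_onI)
    fix x y
    have "\<bar>w x - w y\<bar> \<le> \<bar>3 / \<eta> * infdist x U - 3 / \<eta> * infdist y U\<bar>" unfolding w_def by linarith
    also have "\<dots> = 3 / \<eta> * \<bar>infdist x U - infdist y U\<bar>"
      using \<eta>(1) unfolding right_diff_distrib[symmetric] abs_mult by simp
    also have "\<dots> \<le> 3 / \<eta> * dist x y"
      using \<eta>(1) by (intro mult_left_mono infdist_triangle_abs) auto
    finally have "\<bar>w x - w y\<bar> \<le> 3 / \<eta> * dist x y" .
    moreover have "\<bar>\<psi> x - \<psi> y\<bar> \<le> L * dist x y"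
      using lipschitz_onD[OF \<psi>(1), of x y] by (simp add: dist_real_def)
    ultimately show "dist (v x) (v y) \<le> (L + 3 / \<eta>) * dist x y"
      unfolding v_def dist_real_def distrib_right by linarith
  qed (use L0 \<eta>(1) in simp)
  have nearU: "v y = \<psi> y" if "x \<in> U" "dist x y < \<eta> / 3" for x y
  proof -
    have "infdist y U \<le> dist y x" using that(1) by (rule infdist_le)
    also have "\<dots> < \<eta> / 3" using that(2) by (simp add: dist_commute)
    finally have "3 / \<eta> * infdist y U \<le> 1" using \<eta>(1) by (simp add: field_simps)
    then show ?thesis using \<psi>(3)[of y] by (simp add: v_def w_def)
  qed
  have nearV: "v y = 0" if "x \<in> V" "dist x y < \<eta> / 3" for x y
  proof -
    have "\<eta> \<le> infdist x U"
      unfolding infdist_notempty[OF UV(4)] using \<eta>(2) that(1) UV(4)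
      by (intro cINF_greatest) (auto simp: dist_commute)
    also have "\<dots> \<le> infdist y U + dist x y" by (rule infdist_triangle)
    finally have "3 / \<eta> * infdist y U \<ge> 2" using \<eta>(1) that(2) by (simp add: field_simps)
    then show ?thesis using \<psi>(2)[of y] by (simp add: v_def w_def)
  qed
  have nearZ: "v y = 0" if "y \<in> Z" for y
    using Z(2)[OF that] by (simp add: v_def w_def)
  have vu: "v x = u x" if xF: "x \<in> F" for x
  proof -
    consider "x \<in> U" | "x \<in> V" | "x \<in> Z" using F xF by blast
    then show ?thesis
    proof cases
      case 1 then show ?thesis using nearU[of x x] \<eta>(1) by (simp add: u_def)
    next
      case 2 then have "x \<notin> U" using UV(3) by auto
      then show ?thesis using 2 nearV[of x x] \<eta>(1) by (simp add: u_def)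
    next
      case 3 then show ?thesis using nearZ Z(2) by (simp add: u_def)
    qed
  qed
  have sl: "slope v x \<le> ennreal L * indicator (U \<inter> D) x" if xF: "x \<in> F" for x
  proof -
    have zero: "slope v x = 0" if "open S" "x \<in> S" "\<And>y. y \<in> S \<Longrightarrow> v y = 0" for S
    proof -
      have "slope v x = slope (\<lambda>_. 0) x"
        by (rule slope_cong) (use that eventually_nhds in blast)
      then show ?thesis by simp
    qed
    consider "x \<in> U" | "x \<in> V" | "x \<in> Z" using F xF by blast
    then show ?thesis
    proof cases
      case 1
      have "slope v x = slope \<psi> x"
      proof (rule slope_cong)
        show "\<forall>\<^sub>F y in nhds x. v y = \<psi> y"
          unfolding eventually_nhds_metric using nearU[OF 1] \<eta>(1)
          by (intro exI[of _ "\<eta> / 3"]) (auto simp: dist_commute)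
      qed
      moreover have "slope \<psi> x \<le> ennreal L * indicator (U \<inter> D) x"
        using 1 D(2)[of x] slope_le_lipschitz_constant[OF \<psi>(1), of x] by (cases "x \<in> D") auto
      ultimately show ?thesis by simp
    next
      case 2
      then show ?thesis using zero[of "ball x (\<eta> / 3)"] nearV[OF 2] \<eta>(1) by auto
    next
      case 3
      then show ?thesis using zero[of Z] nearZ Z(1) by auto
    qed
  qed
  have Um: "U \<in> sets borel" using UV(1) by (simp add: borel_compact)
  have fin: "emeasure lborel (E \<inter> S) = ennreal (measure lborel (E \<inter> S))" for S
    using emeasure_bounded_finite[OF bounded_Int[OF disjI1[OF E(2)]], of S]
    by (intro emeasure_eq_ennreal_measure) auto
  have AEF: "AE x in ?\<mu>. x \<in> F" using EF AE_restrict_measure[OF E(1)] by simp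
  have TV: "total_variation ?\<mu> u E \<le> ennreal (L * measure lborel (E \<inter> U \<inter> D))"
  proof -
    have "total_variation ?\<mu> u E \<le> (\<integral>\<^sup>+x. slope v x \<partial>?\<mu>)"
      by (rule total_variation_le_lipschitz[OF lip]) (use AEF vu in \<open>auto elim: eventually_mono\<close>)
    also have "\<dots> \<le> (\<integral>\<^sup>+x. ennreal L * indicator (U \<inter> D) x \<partial>?\<mu>)"
      by (rule nn_integral_mono_AE) (use AEF sl in \<open>auto elim: eventually_mono\<close>)
    also have "\<dots> = ennreal L * emeasure ?\<mu> (U \<inter> D)"
      using Um D(1) by (intro nn_integral_cmult_indicator) (auto simp: restrict_measure_def)
    also have "\<dots> = ennreal L * ennreal (measure lborel (E \<inter> U \<inter> D))"
      using Um D(1) E(1) by (simp add: emeasure_restrict_measure fin Int_assoc)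
    finally show ?thesis using L0 by (simp add: ennreal_mult)
  qed
  have um: "u \<in> borel_measurable borel"
    unfolding u_def using Um lipschitz_on_continuous_on[OF \<psi>(1)]
    by (intro borel_measurable_times borel_measurable_indicator borel_measurable_continuous_onI)
  have L1: "(\<integral>\<^sup>+x. ennreal \<bar>u x\<bar> \<partial>?\<mu>) \<le> ennreal (measure lborel (E \<inter> U \<inter> P))"
  proof -
    have "(\<integral>\<^sup>+x. ennreal \<bar>u x\<bar> \<partial>?\<mu>) \<le> (\<integral>\<^sup>+x. indicator (U \<inter> P) x \<partial>?\<mu>)"
    proof (rule nn_integral_mono)
      fix x
      show "ennreal \<bar>u x\<bar> \<le> indicator (U \<inter> P) x"
        using P(2)[of x] \<psi>(2)[of x] \<psi>(3)[of x]
        by (cases "x \<in> P") (auto simp: u_def split: split_indicator)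
    qed
    also have "\<dots> = emeasure ?\<mu> (U \<inter> P)"
      using Um P(1) by (intro nn_integral_indicator) (auto simp: restrict_measure_def)
    also have "\<dots> = ennreal (measure lborel (E \<inter> U \<inter> P))"
      using Um P(1) E(1) by (simp add: emeasure_restrict_measure fin Int_assoc)
    finally show ?thesis .
  qed
  have "integrable ?\<mu> u"
    using um L1 by (intro integrableI_bounded) (auto simp: restrict_measure_def intro: le_less_trans)
  then show "u \<in> BV lborel E"
    using TV by (auto simp: BV_def intro: le_less_trans)
  show "BV_norm lborel E u \<le> ennreal (measure lborel (E \<inter> U \<inter> P) + L * measure lborel (E \<inter> U \<inter> D))"
    unfolding BV_norm_def using L1 TV L0 by (simp add: add_mono)
qed

section \<open>Lower bounds for the mass of a piece\<close>

text \<open>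
  Cut off between radii \<open>s\<close> and \<open>r\<close>: the norm is at most \<open>2 f(r) / (r - s)\<close>, where \<open>f(t)\<close> is the
  mass of the piece in the disc of radius \<open>t\<close>. In the mass bound take \<open>R = (r - s) / (64 C)\<close>. The
  first term is then at most \<open>\<pi> R\<^sup>2 f(r) / 32\<close>, and smallness of \<open>f(r)\<close> allows the second term
  to be absorbed into half of the left-hand side.
\<close>

lemma local_mass_decay:
  fixes E F U V W :: "(real ^ 2) set"
  assumes MB: "mass_bound C E" and C: "C \<ge> 1"
    and E: "E \<in> sets borel" "bounded E" and EF: "AE x in lborel. x \<in> E \<longrightarrow> x \<in> F"
    and UV: "compact U" "compact V" "U \<inter> V = {}" "U \<noteq> {}"
    and F: "F \<subseteq> U \<union> V \<union> W" and W: "cball z r \<inter> W = {}"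
    and rs: "s < r" "r - s \<le> 1"
    and small: "measure lborel (E \<inter> U \<inter> cball z r) \<le> pi / (16384 * C ^ 3) * (r - s) ^ 3"
  shows "measure lborel (E \<inter> U \<inter> cball z s) \<le> measure lborel (E \<inter> U \<inter> cball z r) / 16"
proof -
  define g where "g = r - s"
  define f where "f t = measure lborel (E \<inter> U \<inter> cball z t)" for t
  have g: "0 < g" "g \<le> 1" using rs by (auto simp: g_def)
  have f0: "0 \<le> f t" for t by (simp add: f_def)
  define \<psi> where "\<psi> x = max 0 (min 1 ((r - dist z x) / g))" for x
  have off: "\<psi> x = 0" if "x \<notin> cball z r" for x
  proof -
    have "(r - dist z x) / g \<le> 0" using that g by (intro divide_nonpos_pos) auto
    then show ?thesis by (simp add: \<psi>_def)
  qed
  have lip: "(1 / g)-lipschitz_on UNIV \<psi>"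
  proof (rule lipschitz_onI)
    fix x y
    have "dist (\<psi> x) (\<psi> y) \<le> \<bar>(r - dist z x) / g - (r - dist z y) / g\<bar>"
      unfolding \<psi>_def dist_real_def by linarith
    also have "\<dots> = \<bar>dist z y - dist z x\<bar> / g"
      using g by (simp add: diff_divide_distrib[symmetric])
    also have "\<dots> \<le> dist x y / g"
      using g dist_triangle[of z x y] dist_triangle[of z y x]
      by (intro divide_right_mono) (auto simp: dist_commute abs_le_iff)
    finally show "dist (\<psi> x) (\<psi> y) \<le> 1 / g * dist x y" by simp
  qed (use g in simp)
  have slope0: "slope \<psi> x = 0" if "x \<notin> cball z r" for x
  proof -
    have "slope \<psi> x = slope (\<lambda>_. 0) x"
    proof (rule slope_cong)
      show "\<forall>\<^sub>F y in nhds x. \<psi> y = 0"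
        unfolding eventually_nhds using that off by (intro exI[of _ "- cball z r"]) auto
    qed
    then show ?thesis by simp
  qed
  define n where "n = f r * (1 + 1 / g)"
  have n0: "0 \<le> n" using f0 g by (simp add: n_def)
  have FZ: "F \<subseteq> U \<union> V \<union> - cball z r" using F W by blast
  note cut = BV_norm_separated_cutoff[OF E EF UV FZ _ _ lip _ _ _ _ _ slope0, of "cball z r" "cball z r"]
  have BV: "(\<lambda>x. indicator U x * \<psi> x) \<in> BV lborel E"
    by (rule cut) (use off in \<open>auto simp: \<psi>_def\<close>)
  have norm: "BV_norm lborel E (\<lambda>x. indicator U x * \<psi> x) \<le> ennreal n"
    unfolding n_def f_def distrib_left mult_1_right mult.commute[of _ "1 / g"]
    by (rule cut) (use off in \<open>auto simp: \<psi>_def\<close>)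
  define R where "R = g / (64 * C)"
  have R: "0 < R" using g C by (simp add: R_def)
  have Um: "U \<in> sets borel" using UV(1) by (simp add: borel_compact)
  have one: "indicator U x * \<psi> x = 1" if "x \<in> E \<inter> U \<inter> cball z s" for x
  proof -
    have "1 \<le> (r - dist z x) / g" using that g by (auto simp: g_def)
    then show ?thesis using that by (simp add: \<psi>_def)
  qed
  have main: "pi * R\<^sup>2 * f s \<le> pi * R\<^sup>2 * (R * (C * n)) + f s * (C * n)"
    unfolding f_def
    using MB[unfolded mass_bound_def, rule_format,
      of "\<lambda>x. indicator U x * \<psi> x" "E \<inter> U \<inter> cball z s" n R, OF BV _ _ one norm n0 R]
      E(1) Um by auto
  have n_le: "n \<le> 2 * f r / g"
  proof -
    have "1 + 1 / g \<le> 2 / g" using g by (simp add: field_simps)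
    then have "n \<le> f r * (2 / g)" unfolding n_def using f0 by (intro mult_left_mono)
    then show ?thesis by (simp add: mult.commute)
  qed
  have Cn: "C * n \<le> C * (2 * f r / g)" using n_le C by (intro mult_left_mono) auto
  have "R * (C * n) \<le> R * (C * (2 * f r / g))"
    by (rule mult_left_mono[OF Cn]) (use R in simp)
  also have "\<dots> = f r / 32" using g C by (simp add: R_def field_simps)
  finally have 1: "R * (C * n) \<le> f r / 32" .
  have 2: "C * n \<le> pi * R\<^sup>2 / 2"
  proof -
    have "C * (2 * f r / g) \<le> C * (2 * (pi / (16384 * C ^ 3) * g ^ 3) / g)"
      using small g C by (intro mult_left_mono divide_right_mono) (auto simp: f_def g_def)
    also have "\<dots> = pi * R\<^sup>2 / 2"
      using g C by (simp add: R_def field_simps power2_eq_square power3_eq_cube)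
    finally show ?thesis using Cn by linarith
  qed
  have "pi * R\<^sup>2 * f s \<le> pi * R\<^sup>2 * (f r / 32) + f s * (pi * R\<^sup>2 / 2)"
  proof (rule order_trans[OF main add_mono])
    show "pi * R\<^sup>2 * (R * (C * n)) \<le> pi * R\<^sup>2 * (f r / 32)" by (rule mult_left_mono[OF 1]) simp
    show "f s * (C * n) \<le> f s * (pi * R\<^sup>2 / 2)" by (rule mult_left_mono[OF 2 f0])
  qed
  then have "pi * R\<^sup>2 * f s \<le> pi * R\<^sup>2 * (f r / 32 + f s / 2)" by (simp add: algebra_simps)
  then have "f s \<le> f r / 32 + f s / 2" using R by (subst (asm) mult_le_cancel_left_pos) auto
  then show ?thesis by (simp add: f_def)
qed

text \<open>
  If the mass were smaller, the decay step could be iterated with radii decreasing from \<open>\<delta>\<close> to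
  \<open>\<delta> / 2\<close>. Each step halves the gap between the radii, so the threshold drops by the factor \<open>8\<close>
  while the mass drops by \<open>16\<close>, and the smallness condition persists. In the limit the disc of
  radius \<open>\<delta> / 2\<close> carries no mass of the piece. But near \<open>z\<close> all of \<open>F\<close> belongs to the piece, and
  \<open>E\<close> has positive measure there.
\<close>

lemma local_mass_lower_bound:
  fixes E F U V W :: "(real ^ 2) set"
  assumes MB: "mass_bound C E" and C: "C \<ge> 1"
    and E: "E \<in> sets borel" "bounded E" and EF: "AE x in lborel. x \<in> E \<longrightarrow> x \<in> F"
    and UV: "compact U" "compact V" "U \<inter> V = {}"
    and F: "F \<subseteq> U \<union> V \<union> W" and W: "cball z \<delta> \<inter> W = {}"
    and \<delta>: "0 < \<delta>" "\<delta> \<le> 1" and z: "z \<in> U" "z \<in> closure (density_one_points E)"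
  shows "pi / (16384 * C ^ 3) * (\<delta> / 4) ^ 3 < measure lborel (E \<inter> U \<inter> cball z \<delta>)"
proof (rule ccontr)
  define \<kappa> where "\<kappa> = pi / (16384 * C ^ 3)"
  have \<kappa>: "\<kappa> > 0" using C by (simp add: \<kappa>_def)
  define f where "f t = measure lborel (E \<inter> U \<inter> cball z t)" for t
  assume "\<not> ?thesis"
  then have f\<delta>: "f \<delta> \<le> \<kappa> * (\<delta> / 4) ^ 3" by (simp add: \<kappa>_def f_def)
  have Um: "U \<in> sets borel" using UV(1) by (simp add: borel_compact)
  have fin: "emeasure lborel (E \<inter> S) = ennreal (measure lborel (E \<inter> S))" for S
    using emeasure_bounded_finite[OF bounded_Int[OF disjI1[OF E(2)]], of S]
    by (intro emeasure_eq_ennreal_measure) auto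
  \<comment> \<open>The radii decrease from \<open>\<delta>\<close> to \<open>\<delta> / 2\<close>, with gaps \<open>\<delta> / 4\<close>, \<open>\<delta> / 8\<close>, and so on.\<close>
  define r where "r i = \<delta> / 2 + \<delta> / 2 ^ (i + 1)" for i :: nat
  have r: "r i - r (Suc i) = \<delta> / 4 * (1 / 2) ^ i" for i
    by (simp add: r_def field_simps)
  have iter: "f (r i) \<le> \<kappa> * (\<delta> / 4) ^ 3 * (1 / 16) ^ i" for i
  proof (induction i)
    case 0
    show ?case using f\<delta> by (simp add: r_def)
  next
    case (Suc i)
    have half: "(1 / 2 :: real) ^ i \<le> 1" by (simp add: power_le_one)
    have "(1 / 16 :: real) ^ i \<le> (1 / 8) ^ i" by (rule power_mono) auto
    then have "\<kappa> * (\<delta> / 4) ^ 3 * (1 / 16) ^ i \<le> \<kappa> * (\<delta> / 4) ^ 3 * (1 / 8) ^ i"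
      using \<kappa> \<delta> by (intro mult_left_mono) auto
    also have "\<dots> = \<kappa> * (r i - r (Suc i)) ^ 3"
    proof -
      have "((1 / 2 :: real) ^ i) ^ 3 = ((1 / 2) ^ 3) ^ i"
        by (simp only: power_mult[symmetric] mult.commute)
      then show ?thesis unfolding r power_mult_distrib by (simp add: power3_eq_cube)
    qed
    finally have small: "f (r i) \<le> \<kappa> * (r i - r (Suc i)) ^ 3" using Suc by linarith
    have "f (r (Suc i)) \<le> f (r i) / 16"
      unfolding f_def
    proof (rule local_mass_decay[OF MB C E EF UV _ F])
      have "r i \<le> \<delta>" using \<delta> by (simp add: r_def field_simps)
      then have "cball z (r i) \<subseteq> cball z \<delta>" by auto
      then show "cball z (r i) \<inter> W = {}" using W by blast
      show "r (Suc i) < r i" using r[of i] \<delta> by (smt (verit) divide_pos_pos mult_pos_pos zero_less_power)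
      have "\<delta> / 4 * (1 / 2) ^ i \<le> 1 * 1" using \<delta> half by (intro mult_mono) auto
      then show "r i - r (Suc i) \<le> 1" unfolding r by simp
    qed (use z small in \<open>auto simp: f_def \<kappa>_def\<close>)
    with Suc show ?case by simp
  qed
  have le: "f (\<delta> / 2) \<le> \<kappa> * (\<delta> / 4) ^ 3 * (1 / 16) ^ i" for i
  proof -
    have "f (\<delta> / 2) \<le> f (r i)"
      unfolding f_def
    proof (rule measure_mono_fmeasurable)
      show "E \<inter> U \<inter> cball z (\<delta> / 2) \<subseteq> E \<inter> U \<inter> cball z (r i)"
      proof -
        have "\<delta> / 2 \<le> r i" using \<delta> by (simp add: r_def)
        then show ?thesis by auto
      qed
      show "E \<inter> U \<inter> cball z (r i) \<in> fmeasurable lborel"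
        using E(1) Um fin[of "U \<inter> cball z (r i)"] by (auto simp: fmeasurable_def Int_assoc)
    qed (use E(1) Um in auto)
    then show ?thesis using iter[of i] by linarith
  qed
  have "(\<lambda>i. \<kappa> * (\<delta> / 4) ^ 3 * (1 / 16) ^ i) \<longlonglongrightarrow> \<kappa> * (\<delta> / 4) ^ 3 * 0"
    by (intro tendsto_mult tendsto_const LIMSEQ_power_zero) auto
  then have "f (\<delta> / 2) \<le> 0"
    by (intro LIMSEQ_le_const) (use le in auto)
  have "z \<notin> V" using z(1) UV(3) by auto
  then obtain t where t: "t > 0" "ball z t \<inter> V = {}"
    using UV(2) compact_imp_closed by (metis closed_def Compl_iff disjoint_eq_subset_Compl openE)
  define t' where "t' = min t (\<delta> / 2)"
  have t': "t' > 0" "ball z t' \<inter> V = {}" "ball z t' \<subseteq> cball z (\<delta> / 2)" "ball z t' \<inter> W = {}"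
    using t \<delta> W by (auto simp: t'_def disjoint_iff)
  obtain y where y: "y \<in> density_one_points E" "y \<in> ball z t'"
    using z(2) t'(1) unfolding closure_approachable by (auto simp: dist_commute)
  then obtain \<tau> where \<tau>: "\<tau> > 0" "ball y \<tau> \<subseteq> ball z t'" by (meson openE open_ball)
  have "0 < emeasure lborel (ball y \<tau> \<inter> E)"
    by (rule density_one_point_emeasure_pos[OF y(1) E(1) \<tau>(1)])
  also have "\<dots> \<le> emeasure lborel (E \<inter> (U \<inter> cball z (\<delta> / 2)))"
  proof (rule emeasure_mono_AE)
    show "AE x in lborel. x \<in> ball y \<tau> \<inter> E \<longrightarrow> x \<in> E \<inter> (U \<inter> cball z (\<delta> / 2))"
      using EF by (rule eventually_mono) (use F t' \<tau> in blast)
  qed (use E(1) Um in auto)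
  also have "\<dots> = ennreal (f (\<delta> / 2))" by (simp add: fin f_def Int_assoc)
  finally show False using \<open>f (\<delta> / 2) \<le> 0\<close> by (simp add: ennreal_neg)
qed

lemma measure_disc_union_le:
  assumes "finite X" "0 \<le> r"
  shows "measure lborel (\<Union>x\<in>X. cball (x :: real ^ 2) r) \<le> real (card X) * (pi * r\<^sup>2)"
proof -
  have "measure lborel (\<Union>x\<in>X. cball x r) \<le> (\<Sum>x\<in>X. measure lborel (cball x r))"
    using assms(1) by (intro measure_UNION_le) auto
  also have "\<dots> = real (card X) * (pi * r\<^sup>2)"
    using assms(2) by (simp add: content_cball unit_ball_vol_2)
  finally show ?thesis .
qed

text \<open>
  Cut off on the discs of radius \<open>2 \<rho>\<close> about \<open>X\<close>, and let \<open>q\<close> be the mass of the piece outside them.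
  Applied at \<open>z\<close>, \<open>local_mass_lower_bound\<close> makes \<open>q\<close> at least \<open>8 \<pi> N \<rho>\<close> with \<open>N\<close> the number of points of
  \<open>X\<close>. This dominates both the mass inside the discs and the variation of the cut-off, so the norm
  is at most \<open>2 q\<close>, and the mass bound with \<open>R = 1 / (4 C)\<close> becomes a lower bound for \<open>q\<close>.
\<close>

lemma piece_mass_lower_bound:
  fixes E F U V X :: "(real ^ 2) set"
  assumes MB: "mass_bound C E" and C: "C \<ge> 1"
    and E: "E \<in> sets borel" "bounded E" and EF: "AE x in lborel. x \<in> E \<longrightarrow> x \<in> F"
    and UV: "compact U" "compact V" "U \<inter> V = {}"
    and X: "finite X" "X \<noteq> {}" and F: "F \<subseteq> U \<union> V \<union> (\<Union>x\<in>X. ball x \<rho>)"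
    and z: "z \<in> U" "z \<in> closure (density_one_points E)" "\<And>x. x \<in> X \<Longrightarrow> \<sigma> \<le> dist x z"
    and \<sigma>: "0 < \<sigma>" "\<sigma> \<le> 1" and \<rho>: "0 < \<rho>" "\<rho> \<le> \<sigma> / 4"
      "8 * pi * real (card X) * \<rho> \<le> pi / (16384 * C ^ 3) * (\<sigma> / 16) ^ 3"
  shows "pi / (64 * C ^ 3) \<le> measure lborel (E \<inter> U)"
proof -
  define D where "D = (\<Union>x\<in>X. cball x (2 * \<rho>))"
  define Q where "Q = E \<inter> U - D"
  have Um: "U \<in> sets borel" using UV(1) by (simp add: borel_compact)
  have clD: "closed D" unfolding D_def using X(1) by (intro closed_UN) auto
  have fin: "E \<inter> S \<in> fmeasurable lborel" if "S \<in> sets borel" for S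
    using emeasure_bounded_finite[OF bounded_Int[OF disjI1[OF E(2)]], of S] that E(1)
    by (auto simp: fmeasurable_def)
  have finQ: "Q \<in> fmeasurable lborel"
    using fin[of "U - D"] Um clD by (simp add: Q_def Int_Diff)
  have finD: "D \<in> fmeasurable lborel"
    unfolding D_def using X(1) emeasure_lborel_cball_finite[of _ "2 * \<rho>"]
    by (intro fmeasurable.finite_UN fmeasurableI) auto
  have Qm: "Q \<in> sets borel" using fmeasurableD[OF finQ] by simp
  define q where "q = measure lborel Q"
  have "pi / (16384 * C ^ 3) * (\<sigma> / 4 / 4) ^ 3 < measure lborel (E \<inter> U \<inter> cball z (\<sigma> / 4))"
  proof (rule local_mass_lower_bound[OF MB C E EF UV F])
    show "cball z (\<sigma> / 4) \<inter> (\<Union>x\<in>X. ball x \<rho>) = {}"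
    proof (rule ccontr)
      assume "\<not> ?thesis"
      then obtain x y where "x \<in> X" "dist z y \<le> \<sigma> / 4" "dist x y < \<rho>" by auto
      then show False using z(3)[of x] dist_triangle[of x z y] \<rho> \<sigma> by (simp add: dist_commute)
    qed
  qed (use \<sigma> z in auto)
  also have "\<dots> \<le> q"
    unfolding q_def
  proof (rule measure_mono_fmeasurable[OF _ _ finQ])
    show "E \<inter> U \<inter> cball z (\<sigma> / 4) \<subseteq> Q"
    proof
      fix y assume y: "y \<in> E \<inter> U \<inter> cball z (\<sigma> / 4)"
      have "y \<notin> cball x (2 * \<rho>)" if "x \<in> X" for x
        using z(3)[OF that] dist_triangle[of x z y] \<rho> \<sigma> y by (auto simp: dist_commute)
      then show "y \<in> Q" using y by (auto simp: Q_def D_def)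
    qed
  qed (use E(1) Um in auto)
  finally have q_big: "8 * pi * real (card X) * \<rho> \<le> q" using \<rho>(3) by simp
  have Dm: "measure lborel D \<le> real (card X) * (pi * (2 * \<rho>)\<^sup>2)"
    unfolding D_def using \<rho> by (intro measure_disc_union_le X(1)) auto
  define \<psi> where "\<psi> x = max 0 (min 1 (infdist x X / \<rho> - 1))" for x
  have lip: "(1 / \<rho>)-lipschitz_on UNIV \<psi>"
  proof (rule lipschitz_onI)
    fix x y
    have "dist (\<psi> x) (\<psi> y) \<le> \<bar>infdist x X / \<rho> - infdist y X / \<rho>\<bar>"
      unfolding \<psi>_def dist_real_def by linarith
    also have "\<dots> = \<bar>infdist x X - infdist y X\<bar> / \<rho>"
      using \<rho> by (simp add: diff_divide_distrib[symmetric])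
    also have "\<dots> \<le> dist x y / \<rho>"
      using \<rho> infdist_triangle_abs by (intro divide_right_mono) auto
    finally show "dist (\<psi> x) (\<psi> y) \<le> 1 / \<rho> * dist x y" by simp
  qed (use \<rho> in simp)
  have far: "\<psi> x = 1" if "x \<notin> D" for x
  proof -
    have "2 * \<rho> \<le> infdist x X"
      unfolding infdist_notempty[OF X(2)]
      using that X(2) by (intro cINF_greatest) (auto simp: D_def dist_commute not_le less_imp_le)
    then have "1 \<le> infdist x X / \<rho> - 1" using \<rho> by (simp add: le_divide_eq)
    then show ?thesis by (simp add: \<psi>_def)
  qed
  have near: "\<psi> x = 0" if x: "x \<in> (\<Union>x\<in>X. ball x \<rho>)" for x
  proof -
    obtain a where "a \<in> X" "dist a x < \<rho>" using x by auto
    then have "a \<in> X" "dist x a < \<rho>" by (simp_all add: dist_commute)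
    then have "infdist x X < \<rho>" using infdist_le le_less_trans by blast
    then have "infdist x X / \<rho> < 1" using \<rho> by simp
    then show ?thesis by (simp add: \<psi>_def)
  qed
  have slope0: "slope \<psi> x = 0" if "x \<notin> D" for x
  proof -
    have "slope \<psi> x = slope (\<lambda>_. 1) x"
    proof (rule slope_cong)
      show "\<forall>\<^sub>F y in nhds x. \<psi> y = 1"
        unfolding eventually_nhds using that far clD by (intro exI[of _ "- D"]) auto
    qed
    then show ?thesis by simp
  qed
  have U0: "U \<noteq> {}" using z(1) by auto
  have opZ: "open (\<Union>x\<in>X. ball x \<rho>)" by auto
  have Db: "D \<in> sets borel" using clD by auto
  note cut = BV_norm_separated_cutoff[OF E EF UV U0 F opZ near lip _ _ _ _ Db slope0, of UNIV]
  have BV: "(\<lambda>x. indicator U x * \<psi> x) \<in> BV lborel E"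
    by (rule cut) (auto simp: \<psi>_def)
  define n where "n = 2 * q"
  have n0: "0 \<le> n" by (simp add: n_def q_def)
  have "BV_norm lborel E (\<lambda>x. indicator U x * \<psi> x)
    \<le> ennreal (measure lborel (E \<inter> U \<inter> UNIV) + 1 / \<rho> * measure lborel (E \<inter> U \<inter> D))"
    by (rule cut) (auto simp: \<psi>_def)
  also have "\<dots> \<le> ennreal n"
  proof (rule ennreal_leI)
    have "measure lborel (E \<inter> U) \<le> measure lborel (Q \<union> D)"
      by (rule measure_mono_fmeasurable[OF _ _ fmeasurable.Un[OF finQ finD]])
        (use E(1) Um in \<open>auto simp: Q_def\<close>)
    also have "\<dots> \<le> q + measure lborel D"
      unfolding q_def using finQ finD by (intro measure_Un_le) (auto dest: fmeasurableD)
    finally have 1: "measure lborel (E \<inter> U) \<le> q + measure lborel D" .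
    have "measure lborel (E \<inter> U \<inter> D) \<le> measure lborel D"
      using finD E(1) Um Db by (intro measure_mono_fmeasurable) auto
    then have "1 / \<rho> * measure lborel (E \<inter> U \<inter> D) \<le> 1 / \<rho> * (real (card X) * (pi * (2 * \<rho>)\<^sup>2))"
      using \<rho> Dm by (intro mult_left_mono) auto
    also have "\<dots> = 4 * pi * real (card X) * \<rho>"
      using \<rho> by (simp add: power2_eq_square)
    finally have 2: "1 / \<rho> * measure lborel (E \<inter> U \<inter> D) \<le> 4 * pi * real (card X) * \<rho>" .
    have "\<rho> * \<rho> \<le> \<rho> * 1" using \<rho> \<sigma> by (intro mult_left_mono) auto
    then have "4 * pi * real (card X) * (\<rho> * \<rho>) \<le> 4 * pi * real (card X) * \<rho>"
      by (intro mult_left_mono) auto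
    then have "measure lborel D \<le> 4 * pi * real (card X) * \<rho>"
    proof -
      have "real (card X) * (pi * (2 * \<rho>)\<^sup>2) = 4 * pi * real (card X) * (\<rho> * \<rho>)"
        by (simp add: power2_eq_square)
      then show ?thesis using Dm \<open>4 * pi * real (card X) * (\<rho> * \<rho>) \<le> _\<close> by linarith
    qed
    then show "measure lborel (E \<inter> U \<inter> UNIV) + 1 / \<rho> * measure lborel (E \<inter> U \<inter> D) \<le> n"
      using 1 2 q_big by (simp add: n_def)
  qed
  finally have norm: "BV_norm lborel E (\<lambda>x. indicator U x * \<psi> x) \<le> ennreal n" .
  have one: "indicator U x * \<psi> x = 1" if "x \<in> Q" for x
    using that far by (auto simp: Q_def)
  define R where "R = 1 / (4 * C)"
  have R: "0 < R" using C by (simp add: R_def)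
  have "pi * R\<^sup>2 * q \<le> pi * R\<^sup>2 * (R * (C * n)) + q * (C * n)"
    unfolding q_def
    using MB[unfolded mass_bound_def, rule_format,
      of "\<lambda>x. indicator U x * \<psi> x" Q n R, OF BV Qm _ one norm n0 R]
    by (auto simp: Q_def)
  also have "R * (C * n) = q / 2" using C by (simp add: R_def n_def)
  finally have "q * (pi * R\<^sup>2 / 2) \<le> q * (2 * C * q)" by (simp add: n_def algebra_simps)
  moreover have "q > 0" using q_big \<rho> X by (smt (verit) card_gt_0_iff mult_pos_pos of_nat_0_less_iff pi_gt_zero)
  ultimately have "pi * R\<^sup>2 / 2 \<le> 2 * C * q" by simp
  then have "pi / (64 * C ^ 3) \<le> q"
    using C by (simp add: R_def field_simps power2_eq_square power3_eq_cube)
  also have "q \<le> measure lborel (E \<inter> U)"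
    unfolding q_def using finQ fin[OF Um] by (intro measure_mono_fmeasurable) (auto simp: Q_def)
  finally show ?thesis .
qed

section \<open>Splitting a closed set at common boundary points\<close>

text \<open>
  Having such a logarithm is an equivalence relation between points of \<open>U\<close>, because logarithms of
  quotients add up. It holds between nearby points by the principal branch, hence throughout the
  connected set \<open>U\<close>.
\<close>

lemma continuous_log_quotient_off_connected:
  fixes U :: "complex set"
  assumes "open U" "connected U" "a \<in> U" "b \<in> U"
  shows "\<exists>g. continuous_on (- U) g \<and> (\<forall>z\<in>- U. exp (g z) = (z - a) / (z - b))"
  (is "?R a b")
proof (rule connected_equivalence_relation[of U a b ?R])
  show "?R y x" if "?R x y" for x y
  proof -
    from that obtain g where "continuous_on (- U) g" "\<forall>z\<in>- U. exp (g z) = (z - x) / (z - y)"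
      by blast
    then show ?thesis
      by (intro exI[of _ "\<lambda>z. - g z"]) (auto simp: exp_minus continuous_on_minus)
  qed
  show "?R x z" if "?R x y" "?R y z" "y \<in> U" for x y z
  proof -
    from that obtain g h where "continuous_on (- U) g" "\<forall>w\<in>- U. exp (g w) = (w - x) / (w - y)"
      "continuous_on (- U) h" "\<forall>w\<in>- U. exp (h w) = (w - y) / (w - z)"
      by blast
    with \<open>y \<in> U\<close> show ?thesis
      by (intro exI[of _ "\<lambda>w. g w + h w"]) (auto simp: exp_add continuous_on_add)
  qed
  show "\<exists>T. openin (top_of_set U) T \<and> x \<in> T \<and> (\<forall>y\<in>T. ?R x y)" if x: "x \<in> U" for x
  proof -
    obtain e where e: "e > 0" "ball x e \<subseteq> U"
      using assms(1) x openE by blast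
    have "?R x y" if y: "y \<in> ball x e" for y
    proof -
      \<comment> \<open>Off \<open>U\<close> the quotient \<open>(z - y) / (z - x)\<close> lies within distance \<open>1\<close> of \<open>1\<close>, where \<open>Ln\<close> is
        continuous.\<close>
      have *: "(z - y) / (z - x) \<notin> \<real>\<^sub>\<le>\<^sub>0" "z \<noteq> x" "z \<noteq> y" if z: "z \<notin> U" for z
      proof -
        have d: "e \<le> norm (z - x)" "norm (y - x) < e"
          using z e(2) y by (auto simp: dist_norm norm_minus_commute subset_eq not_less)
        then show "z \<noteq> x" using e(1) by auto
        show "z \<noteq> y" using d by auto
        have eq: "1 - (z - y) / (z - x) = (y - x) / (z - x)"
          using \<open>z \<noteq> x\<close> by (simp add: field_simps)
        have "norm (1 - (z - y) / (z - x)) < 1"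
          unfolding eq using d \<open>z \<noteq> x\<close> by (simp add: norm_divide)
        then have "Re (1 - (z - y) / (z - x)) < 1"
          using complex_Re_le_cmod le_less_trans by blast
        then have "Re ((z - y) / (z - x)) > 0"
          by simp
        then show "(z - y) / (z - x) \<notin> \<real>\<^sub>\<le>\<^sub>0"
          using complex_nonpos_Reals_iff by force
      qed
      have "continuous_on (- U) (\<lambda>z. - Ln ((z - y) / (z - x)))"
        by (intro continuous_intros continuous_on_Ln') (auto simp: *)
      moreover have "exp (- Ln ((z - y) / (z - x))) = (z - x) / (z - y)" if "z \<in> - U" for z
        using * that by (simp add: exp_minus)
      ultimately show ?thesis by blast
    qed
    then show ?thesis
      using e x assms(1) by (intro exI[of _ "ball x e"]) (auto simp: openin_open_eq)
  qed
qed (use assms in auto)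

text \<open>
  Along the circle, \<open>g\<close> minus the evident branch of \<open>n\<close> times the logarithm takes values in
  \<open>2 \<pi> \<i> \<int>\<close>, so it is constant, whereas the evident branch gains \<open>2 \<pi> \<i> n\<close> in one turn.
\<close>

lemma power_has_no_continuous_log_on_circle:
  fixes a :: complex
  assumes r: "r > 0" and g: "continuous_on (sphere a r) g"
    and eq: "\<And>z. z \<in> sphere a r \<Longrightarrow> exp (g z) = (z - a) powi n"
  shows "n = 0"
proof -
  define p where "p t = a + of_real r * exp (\<i> * of_real t)" for t
  define G where "G t = g (p t) - of_int n * (\<i> * of_real t) - of_int n * of_real (ln r)" for t
  have p: "p t \<in> sphere a r" for t
    using r by (simp add: p_def dist_norm norm_mult)
  have "continuous_on UNIV (\<lambda>t. g (p t))"
    using p by (intro continuous_on_compose2[OF g, of UNIV p]) (auto simp: p_def[abs_def] intro!: continuous_intros)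
  then have cont: "continuous_on UNIV G"
    unfolding G_def by (intro continuous_intros)
  have "exp (G t) = 1" for t
  proof -
    have e1: "exp (g (p t)) = (of_real r * exp (\<i> * of_real t)) powi n"
      using eq[OF p] by (simp add: p_def)
    have e2: "exp (of_int n * (\<i> * of_real t)) = exp (\<i> * of_real t :: complex) powi n"
      by (simp add: exp_power_int mult.commute)
    have e3: "exp (of_int n * of_real (ln r) :: complex) = of_real r powi n"
      unfolding exp_power_int[symmetric] exp_of_real using r by simp
    show ?thesis
      unfolding G_def exp_diff e1 e2 e3 using r by (simp add: power_int_mult_distrib)
  qed
  then have "\<exists>k::int. G t = of_int (2 * k) * pi * \<i>" for t
    using exp_eq[of "G t" 0] by simp
  then obtain k :: "real \<Rightarrow> int" where "\<And>t. G t = of_int (2 * k t) * pi * \<i>" by metis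
  then have k: "G t = of_int (k t) * (2 * of_real pi * \<i>)" for t by simp
  have "G constant_on UNIV"
  proof (rule continuous_discrete_range_constant[OF connected_UNIV cont])
    fix x :: real
    have "2 * pi \<le> norm (G y - G x)" if "G y \<noteq> G x" for y
    proof -
      have "k y \<noteq> k x" using that k by metis
      then have "1 \<le> \<bar>real_of_int (k y - k x)\<bar>" by linarith
      then have "1 * (2 * pi) \<le> \<bar>real_of_int (k y - k x)\<bar> * (2 * pi)"
        by (intro mult_right_mono) auto
      also have "\<dots> = norm (of_int (k y - k x) * (2 * of_real pi * \<i>) :: complex)"
        by (simp add: norm_mult del: of_int_diff)
      also have "of_int (k y - k x) * (2 * of_real pi * \<i>) = G y - G x"
        by (simp add: k algebra_simps)
      finally show ?thesis by simp
    qed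
    then show "\<exists>e>0. \<forall>y. y \<in> UNIV \<and> G y \<noteq> G x \<longrightarrow> e \<le> norm (G y - G x)"
      by (intro exI[of _ "2 * pi"]) auto
  qed
  then have "G 0 = G (2 * pi)" by (metis constant_on_def UNIV_I)
  moreover have "p (2 * pi) = p 0" by (simp add: p_def exp_two_pi_i exp_two_pi_i' mult.commute)
  ultimately have "of_int n * (\<i> * of_real (2 * pi)) = (0::complex)"
    by (simp add: G_def)
  then show ?thesis by simp
qed

text \<open>
  Fewer homogeneous linear equations than unknowns: Gaussian elimination over the integers.
\<close>

lemma integer_relation:
  fixes d :: "'a \<Rightarrow> 'b \<Rightarrow> int"
  assumes "finite I" "finite A" "card I < card A"
  shows "\<exists>n. (\<exists>a\<in>A. n a \<noteq> 0) \<and> (\<forall>i\<in>I. (\<Sum>a\<in>A. n a * d a i) = 0)"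
  using assms
proof (induction I arbitrary: A d rule: finite_induct)
  case empty
  then have "A \<noteq> {}" by auto
  then show ?case by (intro exI[of _ "\<lambda>_. 1"]) auto
next
  case (insert i I)
  show ?case
  proof (cases "\<forall>a\<in>A. d a i = 0")
    case True
    obtain n where "\<exists>a\<in>A. n a \<noteq> 0" "\<forall>j\<in>I. (\<Sum>a\<in>A. n a * d a j) = 0"
      using insert.IH[of A d] insert.prems insert.hyps by auto
    with True show ?thesis by (intro exI[of _ n]) auto
  next
    case False
    then obtain b where b: "b \<in> A" "d b i \<noteq> 0" by auto
    \<comment> \<open>Eliminate the equation \<open>i\<close> with the pivot \<open>d b i\<close>.\<close>
    define d' where "d' a j = d b i * d a j - d a i * d b j" for a j
    obtain n where n: "\<exists>a\<in>A - {b}. n a \<noteq> 0" "\<forall>j\<in>I. (\<Sum>a\<in>A - {b}. n a * d' a j) = 0"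
      using insert.IH[of "A - {b}" d'] insert.prems insert.hyps b by (auto simp: less_diff_conv)
    define n' where "n' a = (if a = b then - (\<Sum>c\<in>A - {b}. n c * d c i) else d b i * n a)" for a
    have sum: "(\<Sum>a\<in>A. n' a * d a j) = (\<Sum>a\<in>A - {b}. n a * d' a j)" for j
    proof -
      have "(\<Sum>a\<in>A. n' a * d a j) = n' b * d b j + (\<Sum>a\<in>A - {b}. n' a * d a j)"
        using b insert.prems by (simp add: sum.remove)
      also have "(\<Sum>a\<in>A - {b}. n' a * d a j) = (\<Sum>a\<in>A - {b}. d b i * n a * d a j)"
        by (rule sum.cong) (auto simp: n'_def)
      also have "n' b * d b j = (\<Sum>a\<in>A - {b}. - (n a * d a i * d b j))"
        by (simp add: n'_def sum_distrib_right sum_negf)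
      finally show ?thesis
        by (simp add: d'_def algebra_simps flip: sum.distrib)
    qed
    have "(\<Sum>a\<in>A - {b}. n a * d' a i) = 0" by (simp add: d'_def mult.commute)
    then have "\<forall>j\<in>insert i I. (\<Sum>a\<in>A. n' a * d a j) = 0"
      using n(2) by (auto simp: sum)
    moreover have "\<exists>a\<in>A. n' a \<noteq> 0"
      using n(1) b by (auto simp: n'_def)
    ultimately show ?thesis by blast
  qed
qed


lemma continuous_integer_valued_imp_locally_constant:
  fixes f :: "'a::metric_space \<Rightarrow> int"
  assumes "continuous_on S (\<lambda>z. of_int (f z) :: complex)" "z \<in> S"
  shows "\<exists>e>0. \<forall>w\<in>S. dist w z < e \<longrightarrow> f w = f z"
proof -
  obtain e where e: "e > 0" "\<And>w. w \<in> S \<Longrightarrow> dist w z < e \<Longrightarrow> dist (of_int (f w) :: complex) (of_int (f z)) < 1"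
    using assms unfolding continuous_on_iff by (metis zero_less_one)
  have "f w = f z" if "w \<in> S" "dist w z < e" for w
  proof -
    have "norm (of_int (f w - f z) :: complex) < 1"
      using e(2)[OF that] by (simp add: dist_norm)
    then have "real_of_int \<bar>f w - f z\<bar> < 1" by (simp only: norm_of_int)
    then have "\<bar>f w - f z\<bar> < 1" by linarith
    then show ?thesis by simp
  qed
  with e(1) show ?thesis by blast
qed

lemma locally_constant_imp_closed_vimage:
  fixes L :: "'a::metric_space \<Rightarrow> 'b"
  assumes "closed S" and "\<And>z. z \<in> S \<Longrightarrow> \<exists>e>0. \<forall>w\<in>S. dist w z < e \<longrightarrow> L w = L z"
  shows "closed {z \<in> S. L z \<in> V}"
proof (unfold closed_limpt, intro allI impI)
  fix z assume z: "z islimpt {z \<in> S. L z \<in> V}"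
  then have "z islimpt S" by (rule islimpt_subset) auto
  then have "z \<in> S" using assms(1) closed_limpt by blast
  then obtain e where "e > 0" "\<And>w. w \<in> S \<Longrightarrow> dist w z < e \<Longrightarrow> L w = L z"
    using assms(2) by blast
  with z \<open>z \<in> S\<close> show "z \<in> {z \<in> S. L z \<in> V}"
    unfolding islimpt_approachable by (metis (mono_tags, lifting) mem_Collect_eq)
qed

text \<open>
  On the disc about \<open>a\<close> all factors other than the power of \<open>z - a\<close> are free of zeros and poles, so
  their product has a logarithm there. Subtracting it leaves a logarithm of the power on the circle.
\<close>

lemma no_log_of_product_off_balls:
  fixes X :: "complex set"
  assumes X: "finite X" "x0 \<in> X" and s: "\<sigma> > 0"
    and disj: "\<And>x y. x \<in> X \<Longrightarrow> y \<in> X \<Longrightarrow> x \<noteq> y \<Longrightarrow> cball x \<sigma> \<inter> cball y \<sigma> = {}"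
    and H: "continuous_on (- (\<Union>x\<in>X. ball x \<sigma>)) H"
    and eq: "\<And>z. z \<notin> (\<Union>x\<in>X. ball x \<sigma>) \<Longrightarrow>
               exp (H z) = (\<Prod>b\<in>X - {x0}. ((z - b) / (z - x0)) powi n b)"
    and a: "a \<in> X - {x0}"
  shows "n a = 0"
proof -
  define Q where "Q z = (1 / (z - x0)) powi n a * (\<Prod>b\<in>X - {x0} - {a}. ((z - b) / (z - x0)) powi n b)" for z
  have ne: "z \<noteq> b" if "z \<in> cball a \<sigma>" "b \<in> X" "b \<noteq> a" for z b
    using disj[of a b] that a s by auto
  have Q0: "Q z \<noteq> 0" if "z \<in> cball a \<sigma>" for z
    using ne[OF that] X a by (auto simp: Q_def)
  have "continuous_on (cball a \<sigma>) Q"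
    unfolding Q_def
  proof (intro continuous_intros ballI disjI2)
    fix z b assume "z \<in> cball a \<sigma>" "b \<in> X - {x0} - {a}"
    then show "z - x0 \<noteq> 0" "(z - b) / (z - x0) \<noteq> 0"
      using ne[of z x0] ne[of z b] X a by auto
  next
    fix z assume "z \<in> cball a \<sigma>"
    then show "z - x0 \<noteq> 0" "1 / (z - x0) \<noteq> 0"
      using ne[of z x0] X a by auto
  qed
  then obtain q where q: "continuous_on (cball a \<sigma>) q" "\<And>z. z \<in> cball a \<sigma> \<Longrightarrow> Q z = exp (q z)"
    using continuous_logarithm_on_cball Q0 by blast
  have sub: "sphere a \<sigma> \<subseteq> - (\<Union>x\<in>X. ball x \<sigma>)"
  proof
    fix z assume z: "z \<in> sphere a \<sigma>"
    then have "z \<notin> ball x \<sigma>" if "x \<in> X" for x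
      using disj[of a x] that a by (cases "x = a") auto
    then show "z \<in> - (\<Union>x\<in>X. ball x \<sigma>)" by auto
  qed
  show ?thesis
  proof (rule power_has_no_continuous_log_on_circle[OF s])
    show "continuous_on (sphere a \<sigma>) (\<lambda>z. H z - q z)"
      by (intro continuous_intros continuous_on_subset[OF H sub] continuous_on_subset[OF q(1)]) auto
    fix z assume z: "z \<in> sphere a \<sigma>"
    then have zc: "z \<in> cball a \<sigma>" by auto
    have "exp (H z) = (\<Prod>b\<in>X - {x0}. ((z - b) / (z - x0)) powi n b)"
      using eq sub z by blast
    also have "\<dots> = ((z - a) / (z - x0)) powi n a * (\<Prod>b\<in>X - {x0} - {a}. ((z - b) / (z - x0)) powi n b)"
      using X a by (subst prod.remove[of _ a]) auto
    also have "((z - a) / (z - x0)) powi n a = (z - a) powi n a * (1 / (z - x0)) powi n a"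
      by (simp flip: power_int_mult_distrib)
    finally have "exp (H z) = (z - a) powi n a * Q z"
      by (simp add: Q_def mult.assoc)
    then show "exp (H z - q z) = (z - a) powi n a"
      using q(2)[OF zc] Q0[OF zc] by (simp add: exp_diff)
  qed
qed

lemma connected_Un_balls:
  fixes A :: "'a::real_normed_vector set"
  assumes "connected A" "X \<subseteq> closure A" "r > 0"
  shows "connected (A \<union> (\<Union>x\<in>X. ball x r))"
proof -
  have "connected (\<Union>x\<in>X. A \<union> ball x r)" if "X \<noteq> {}"
  proof (rule connected_Union)
    fix S assume "S \<in> (\<lambda>x. A \<union> ball x r) ` X"
    then obtain x where x: "x \<in> X" "S = A \<union> ball x r" by auto
    then have "A \<inter> ball x r \<noteq> {}"
      using assms(2,3) by (meson closure_approachableD disjoint_iff mem_ball subsetD)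
    then show "connected S" unfolding x by (intro connected_Un assms(1)) auto
  next
    have "A \<noteq> {}" using that assms(2) by auto
    then show "\<Inter> ((\<lambda>x. A \<union> ball x r) ` X) \<noteq> {}" by auto
  qed
  moreover have "(\<Union>x\<in>X. A \<union> ball x r) = A \<union> (\<Union>x\<in>X. ball x r)" if "X \<noteq> {}"
    using that by auto
  ultimately show ?thesis using assms(1) by (cases "X = {}") auto
qed

text \<open>
  The label \<open>L z\<close> of a point \<open>z\<close> records, for each \<open>a\<close>, the integer by which the two logarithms of
  \<open>(z - a) / (z - x0)\<close> differ at \<open>z\<close>. The first conclusion says that the sets of points with given
  labels are relatively clopen; \<open>Z\<close> provides one point outside the discs of radius \<open>\<sigma>\<close> for each of
  \<open>card X\<close> labels. At least two points are needed: if \<open>X\<close> is a single point, the disc of radius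
  \<open>\<sigma>\<close> may contain all of \<open>F\<close>.
\<close>

lemma common_boundary_points_split:
  fixes F A B X :: "complex set"
  assumes F: "closed F" "closed (F \<union> A)" "A \<inter> F = {}" "B \<inter> F = {}" "A \<inter> B = {}"
    and A: "open A" "connected A" and B: "open B" "connected B"
    and X: "finite X" "card X \<ge> 2" "X \<subseteq> closure A" "X \<subseteq> closure B"
    and \<rho>: "0 < \<rho>" "\<rho> \<le> \<sigma>"
    and disj: "\<And>x y. x \<in> X \<Longrightarrow> y \<in> X \<Longrightarrow> x \<noteq> y \<Longrightarrow> cball x \<sigma> \<inter> cball y \<sigma> = {}"
  obtains L :: "complex \<Rightarrow> complex \<Rightarrow> int" and Z where
    "\<forall>V. closed {z \<in> F - (\<Union>x\<in>X. ball x \<rho>). L z \<in> V}"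
    "Z \<subseteq> F - (\<Union>x\<in>X. ball x \<sigma>)" "finite Z" "card Z = card X" "inj_on L Z"
proof -
  obtain x0 where x0: "x0 \<in> X" using X(2) by fastforce
  define Br where "Br = (\<Union>x\<in>X. ball x \<rho>)"
  define Bs where "Bs = (\<Union>x\<in>X. ball x \<sigma>)"
  have sub: "Br \<subseteq> Bs" and op: "open Br" "open Bs" and XBr: "X \<subseteq> Br"
    unfolding Br_def Bs_def using \<rho> by auto
  have "\<exists>g. continuous_on (- (A \<union> Br)) g \<and> (\<forall>z\<in>- (A \<union> Br). exp (g z) = (z - a) / (z - x0))"
    if "a \<in> X" for a
    using continuous_log_quotient_off_connected[of "A \<union> Br" a x0] A op XBr that x0
      connected_Un_balls[OF A(2) X(3) \<rho>(1)] by (auto simp: Br_def[symmetric])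
  then obtain g where g: "\<And>a. a \<in> X \<Longrightarrow> continuous_on (- (A \<union> Br)) (g a)"
    "\<And>a z. a \<in> X \<Longrightarrow> z \<notin> A \<union> Br \<Longrightarrow> exp (g a z) = (z - a) / (z - x0)"
    by (metis ComplI)
  have "\<exists>g. continuous_on (- (B \<union> Br)) g \<and> (\<forall>z\<in>- (B \<union> Br). exp (g z) = (z - a) / (z - x0))"
    if "a \<in> X" for a
    using continuous_log_quotient_off_connected[of "B \<union> Br" a x0] B op XBr that x0
      connected_Un_balls[OF B(2) X(4) \<rho>(1)] by (auto simp: Br_def[symmetric])
  then obtain h where h: "\<And>a. a \<in> X \<Longrightarrow> continuous_on (- (B \<union> Br)) (h a)"
    "\<And>a z. a \<in> X \<Longrightarrow> z \<notin> B \<union> Br \<Longrightarrow> exp (h a z) = (z - a) / (z - x0)"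
    by (metis ComplI)
  have FA: "F - Br \<subseteq> - (A \<union> Br)" and FB: "F - Br \<subseteq> - (B \<union> Br)" using F by auto
  have "\<exists>k. g a z = h a z + of_int k * (2 * of_real pi * \<i>)" if "a \<in> X" "z \<in> F - Br" for a z
  proof -
    have "z \<notin> A \<union> Br" "z \<notin> B \<union> Br" using that FA FB by blast+
    then have "exp (g a z) = exp (h a z)" using g(2) h(2) that(1) by metis
    then obtain k :: int where "g a z = h a z + of_int (2 * k) * pi * \<i>" unfolding exp_eq by blast
    then show ?thesis by (intro exI[of _ k]) simp
  qed
  then obtain d where d: "\<And>a z. a \<in> X \<Longrightarrow> z \<in> F - Br \<Longrightarrow> g a z = h a z + of_int (d a z) * (2 * of_real pi * \<i>)"
    by metis
  define L where "L z = (\<lambda>a. if a \<in> X then d a z else 0)" for z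
  have loc: "\<exists>e>0. \<forall>w\<in>F - Br. dist w z < e \<longrightarrow> L w = L z" if z: "z \<in> F - Br" for z
  proof -
    have "\<exists>e>0. \<forall>w\<in>F - Br. dist w z < e \<longrightarrow> d a w = d a z" if "a \<in> X" for a
    proof (rule continuous_integer_valued_imp_locally_constant[OF _ z])
      have "continuous_on (F - Br) (\<lambda>z. (g a z - h a z) / (2 * of_real pi * \<i>))"
        using that by (intro continuous_intros continuous_on_subset[OF g(1) FA] continuous_on_subset[OF h(1) FB]) auto
      then show "continuous_on (F - Br) (\<lambda>z. of_int (d a z) :: complex)"
        by (rule continuous_on_eq) (use d that in auto)
    qed
    then obtain e where e: "\<And>a. a \<in> X \<Longrightarrow> e a > 0"
      "\<And>a w. a \<in> X \<Longrightarrow> w \<in> F - Br \<Longrightarrow> dist w z < e a \<Longrightarrow> d a w = d a z" by metis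
    have "Min (e ` X) > 0" using X(1) x0 e(1) by (subst Min_gr_iff) auto
    moreover have "L w = L z" if "w \<in> F - Br" "dist w z < Min (e ` X)" for w
    proof -
      have "dist w z < e a" if "a \<in> X" for a
        using \<open>dist w z < _\<close> X(1) that by (meson Min_le finite_imageI image_eqI less_le_trans)
      then show ?thesis using e(2) that by (auto simp: L_def)
    qed
    ultimately show ?thesis by blast
  qed
  have closed: "closed {z \<in> F - Br. L z \<in> V}" for V
    by (rule locally_constant_imp_closed_vimage[OF _ loc]) (use F op in \<open>auto intro: closed_Diff\<close>)
  have many: "card X \<le> card (L ` (F - Bs))" if fin: "finite (L ` (F - Bs))"
  proof (rule ccontr)
    assume less: "\<not> ?thesis"
    \<comment> \<open>With the labels \<open>W\<close> too few, and normalised by one of them, the relation makes \<open>\<Sum> n a * d a z\<close>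
      constant on \<open>F\<close> outside the large discs.\<close>
    define W where "W = L ` (F - Bs)"
    obtain v0 where v0: "v0 \<in> W \<or> W = {}" by blast
    have cardX: "card (X - {x0}) = card X - 1" using x0 X by simp
    have "card (W - {v0}) < card (X - {x0})"
      using v0 less fin X(2) unfolding cardX W_def[symmetric]
      by (cases "W = {}") (auto simp: card_Diff_singleton)
    then obtain n where n: "\<exists>a\<in>X - {x0}. n a \<noteq> 0"
      "\<And>v. v \<in> W - {v0} \<Longrightarrow> (\<Sum>a\<in>X - {x0}. n a * (v a - v0 a)) = 0"
      using integer_relation[of "W - {v0}" "X - {x0}" "\<lambda>a v. v a - v0 a"] fin X(1)
      by (auto simp: W_def)
    define c where "c = (\<Sum>a\<in>X - {x0}. n a * v0 a)"
    have rel: "(\<Sum>a\<in>X - {x0}. n a * d a z) = c" if z: "z \<in> F - Bs" for z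
    proof -
      have "L z \<in> W" using z by (auto simp: W_def)
      then have "(\<Sum>a\<in>X - {x0}. n a * (L z a - v0 a)) = 0"
        using n(2)[of "L z"] by (cases "L z = v0") auto
      then have "(\<Sum>a\<in>X - {x0}. n a * L z a) = c"
        by (simp add: right_diff_distrib sum_subtractf c_def)
      then show ?thesis by (simp add: L_def)
    qed
    \<comment> \<open>Two logarithms of the product, off \<open>A\<close> and on \<open>F \<union> A\<close>. The constant \<open>c\<close> makes them
      agree on \<open>F\<close>.\<close>
    define G where "G z = (\<Sum>a\<in>X - {x0}. of_int (n a) * g a z)" for z
    define K where "K z = (\<Sum>a\<in>X - {x0}. of_int (n a) * h a z) + of_int c * (2 * of_real pi * \<i>)" for z
    have cG: "continuous_on (- A - Bs) G"
      unfolding G_def using sub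
      by (intro continuous_intros continuous_on_subset[OF g(1)]) auto
    have cK: "continuous_on (F \<union> A - Bs) K"
      unfolding K_def using sub F
      by (intro continuous_intros continuous_on_subset[OF h(1)]) auto
    have GK: "G z = K z" if z: "z \<in> F - Bs" for z
    proof -
      have z': "z \<in> F - Br" using z sub by auto
      have "G z = (\<Sum>a\<in>X - {x0}. of_int (n a) * h a z + of_int (n a * d a z) * (2 * of_real pi * \<i>))"
        unfolding G_def by (rule sum.cong) (use d z' in \<open>auto simp: algebra_simps\<close>)
      also have "\<dots> = (\<Sum>a\<in>X - {x0}. of_int (n a) * h a z)
                     + of_int (\<Sum>a\<in>X - {x0}. n a * d a z) * (2 * of_real pi * \<i>)"
        by (simp add: sum.distrib sum_distrib_right)
      also have "\<dots> = K z" unfolding rel[OF z] K_def ..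
      finally show ?thesis .
    qed
    define H where "H z = (if z \<in> A then K z else G z)" for z
    have "continuous_on ((F \<union> A - Bs) \<union> (- A - Bs)) H"
      unfolding H_def
    proof (rule continuous_on_cases[OF _ _ cK cG])
      show "closed (- A - Bs)" "closed (F \<union> A - Bs)"
        using A(1) op(2) F(2) by (auto intro!: closed_Diff)
      show "\<forall>z. z \<in> F \<union> A - Bs \<and> z \<notin> A \<or> z \<in> - A - Bs \<and> z \<in> A \<longrightarrow> K z = G z"
        using GK by auto
    qed
    moreover have "(F \<union> A - Bs) \<union> (- A - Bs) = - Bs" by auto
    ultimately have cH: "continuous_on (- Bs) H" by simp
    have eH: "exp (H z) = (\<Prod>b\<in>X - {x0}. ((z - b) / (z - x0)) powi n b)" if z: "z \<notin> Bs" for z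
    proof (cases "z \<in> A")
      case True
      then have "z \<notin> B \<union> Br" using sub z F by auto
      then have "exp (of_int (n a) * h a z) = ((z - a) / (z - x0)) powi n a" if "a \<in> X" for a
        using h(2)[OF that] exp_power_int[of "h a z" "n a"] by simp
      then have "exp (\<Sum>a\<in>X - {x0}. of_int (n a) * h a z) = (\<Prod>b\<in>X - {x0}. ((z - b) / (z - x0)) powi n b)"
        using X by (simp add: exp_sum)
      moreover have "exp (of_int c * (2 * of_real pi * \<i>)) = (1::complex)"
        using exp_integer_2pi[of "of_int c"] by (simp add: mult_ac)
      ultimately show ?thesis using True by (simp add: H_def K_def exp_add)
    next
      case False
      then have "z \<notin> A \<union> Br" using sub z by auto
      then have "exp (of_int (n a) * g a z) = ((z - a) / (z - x0)) powi n a" if "a \<in> X" for a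
        using g(2)[OF that] exp_power_int[of "g a z" "n a"] by simp
      then show ?thesis using False X by (simp add: H_def G_def exp_sum)
    qed
    have "n a = 0" if "a \<in> X - {x0}" for a
      using no_log_of_product_off_balls[OF X(1) x0 _ disj, of H n a] cH eH that \<rho>
      unfolding Bs_def by auto
    with n(1) show False by blast
  qed
  obtain W where W: "W \<subseteq> L ` (F - Bs)" "finite W" "card W = card X"
  proof (cases "finite (L ` (F - Bs))")
    case True
    then show ?thesis using many that by (meson obtain_subset_with_card_n)
  next
    case False
    then show ?thesis using that infinite_arbitrarily_large by metis
  qed
  obtain Z where Z: "Z \<subseteq> F - Bs" "inj_on L Z" "L ` Z = W"
    using W(1) by (metis subset_image_inj)
  show thesis
  proof
    show "\<forall>V. closed {z \<in> F - (\<Union>x\<in>X. ball x \<rho>). L z \<in> V}"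
      using closed unfolding Br_def by blast
    show "Z \<subseteq> F - (\<Union>x\<in>X. ball x \<sigma>)" using Z(1) unfolding Bs_def .
    show "finite Z" using Z W(2) finite_image_iff by blast
    show "card Z = card X" using Z W(3) card_image by metis
  qed (fact Z)
qed

definition plane_to_complex :: "real ^ 2 \<Rightarrow> complex" where
  "plane_to_complex x = Complex (x $ 1) (x $ 2)"

lemma plane_to_complex:
  "linear plane_to_complex" "inj plane_to_complex" "surj plane_to_complex"
  "dist (plane_to_complex x) (plane_to_complex y) = dist x y"
proof -
  show "linear plane_to_complex"
    by (rule linearI) (auto simp: plane_to_complex_def complex_eq_iff)
  show "inj plane_to_complex"
    by (rule injI) (auto simp: plane_to_complex_def vec_eq_iff forall_2)
  show "surj plane_to_complex"
  proof (rule surjI)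
    show "plane_to_complex (vector [Re z, Im z]) = z" for z
      by (simp add: plane_to_complex_def)
  qed
  show "dist (plane_to_complex x) (plane_to_complex y) = dist x y"
    by (simp add: plane_to_complex_def dist_complex_def cmod_def dist_vec_def L2_set_def
        sum_2 dist_real_def)
qed

text \<open>
  The Euclidean plane is identified with the complex numbers by an isometry, under which all
  hypotheses and conclusions are invariant.
\<close>

lemma common_boundary_points_split_plane:
  fixes F A B X :: "(real ^ 2) set"
  assumes F: "closed F" "closed (F \<union> A)" "A \<inter> F = {}" "B \<inter> F = {}" "A \<inter> B = {}"
    and A: "open A" "connected A" and B: "open B" "connected B"
    and X: "finite X" "card X \<ge> 2" "X \<subseteq> closure A" "X \<subseteq> closure B"
    and \<rho>: "0 < \<rho>" "\<rho> \<le> \<sigma>"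
    and disj: "\<And>x y. x \<in> X \<Longrightarrow> y \<in> X \<Longrightarrow> x \<noteq> y \<Longrightarrow> cball x \<sigma> \<inter> cball y \<sigma> = {}"
  obtains L :: "real ^ 2 \<Rightarrow> complex \<Rightarrow> int" and Z where
    "\<forall>V. closed {z \<in> F - (\<Union>x\<in>X. ball x \<rho>). L z \<in> V}"
    "Z \<subseteq> F - (\<Union>x\<in>X. ball x \<sigma>)" "finite Z" "card Z = card X" "inj_on L Z"
proof -
  let ?c = plane_to_complex
  note lin = plane_to_complex(1) and inj = plane_to_complex(2) and surj = plane_to_complex(3)
  have cont: "continuous_on S ?c" for S by (rule linear_continuous_on_compose[OF continuous_on_id lin, simplified])
  have img: "?c ` S \<inter> ?c ` T = {}" if "S \<inter> T = {}" for S T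
    using that inj by (auto dest: injD)
  have ball: "?c z \<in> ball (?c x) r \<longleftrightarrow> z \<in> ball x r" for x z r by (simp add: plane_to_complex(4))
  have clF: "closed (?c ` F)" and clFA: "closed (?c ` F \<union> ?c ` A)"
    unfolding image_Un[symmetric] using F closed_injective_linear_image[OF _ lin inj] by auto
  have opn: "open (?c ` A)" "open (?c ` B)"
    using A B open_surjective_linear_image[OF _ lin surj] by auto
  have con: "connected (?c ` A)" "connected (?c ` B)"
    using A B connected_continuous_image[OF cont] by auto
  have cardX: "card (?c ` X) = card X" using card_image[OF inj_on_subset[OF inj]] by simp
  have clX: "?c ` X \<subseteq> closure (?c ` A)" "?c ` X \<subseteq> closure (?c ` B)"
    using X unfolding closure_injective_linear_image[OF lin inj, symmetric] by auto
  have disj': "cball x \<sigma> \<inter> cball y \<sigma> = {}"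
    if x: "x \<in> ?c ` X" and y: "y \<in> ?c ` X" and "x \<noteq> y" for x y
  proof -
    obtain x' y' where xy: "x' \<in> X" "y' \<in> X" "x = ?c x'" "y = ?c y'" using x y by auto
    have "w \<notin> cball y \<sigma>" if "w \<in> cball x \<sigma>" for w
    proof -
      obtain w' where "w = ?c w'" using surj by (metis surjD)
      then show ?thesis
        using disj[of x' y'] xy that \<open>x \<noteq> y\<close> by (auto simp: plane_to_complex(4) disjoint_iff)
    qed
    then show ?thesis by blast
  qed
  obtain L :: "complex \<Rightarrow> complex \<Rightarrow> int" and Z where L: "\<forall>V. closed {z \<in> ?c ` F - (\<Union>x\<in>?c ` X. ball x \<rho>). L z \<in> V}"
    and Z: "Z \<subseteq> ?c ` F - (\<Union>x\<in>?c ` X. ball x \<sigma>)" "finite Z" "card Z = card (?c ` X)" "inj_on L Z"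
    by (rule common_boundary_points_split[OF clF clFA img[OF F(3)] img[OF F(4)] img[OF F(5)]
        opn(1) con(1) opn(2) con(2) finite_imageI[OF X(1)] X(2)[folded cardX] clX \<rho> disj'])
  have "inj_on ?c (?c -` Z)" using inj inj_on_subset by blast
  then have cardZ: "card (?c -` Z) = card Z" using card_image surj by (metis surj_image_vimage_eq)
  show thesis
  proof (rule that[of "L \<circ> ?c" "?c -` Z"])
    have "{z \<in> F - (\<Union>x\<in>X. ball x \<rho>). (L \<circ> ?c) z \<in> V}
      = ?c -` {z \<in> ?c ` F - (\<Union>x\<in>?c ` X. ball x \<rho>). L z \<in> V}" for V
      using inj ball by (auto dest: injD)
    moreover have "closed (?c -` {z \<in> ?c ` F - (\<Union>x\<in>?c ` X. ball x \<rho>). L z \<in> V})" for V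
      by (rule closed_vimage[OF _ cont]) (use L in blast)
    ultimately show "\<forall>V. closed {z \<in> F - (\<Union>x\<in>X. ball x \<rho>). (L \<circ> ?c) z \<in> V}"
      by simp
    show "?c -` Z \<subseteq> F - (\<Union>x\<in>X. ball x \<sigma>)"
    proof
      fix z assume "z \<in> ?c -` Z"
      then have "?c z \<in> ?c ` F" "?c z \<notin> (\<Union>x\<in>?c ` X. ball x \<sigma>)" using Z(1) by auto
      then show "z \<in> F - (\<Union>x\<in>X. ball x \<sigma>)" using inj ball by (auto dest: injD)
    qed
    show "finite (?c -` Z)" using Z(2) inj by (simp add: finite_vimageI)
    show "card (?c -` Z) = card X"
      using cardZ Z(3) card_image[OF inj_on_subset[OF inj]] by simp
    show "inj_on (L \<circ> ?c) (?c -` Z)"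
      using Z(4) inj by (auto simp: inj_on_def)
  qed
qed

section \<open>Finiteness of the common boundary\<close>

lemma finite_separation_radius:
  fixes X :: "'a::metric_space set"
  assumes "finite X"
  obtains \<sigma> where "0 < \<sigma>" "\<sigma> \<le> 1"
    "\<And>x y. x \<in> X \<Longrightarrow> y \<in> X \<Longrightarrow> x \<noteq> y \<Longrightarrow> cball x \<sigma> \<inter> cball y \<sigma> = {}"
proof -
  define S where "S = insert 3 ((\<lambda>(x, y). dist x y) ` {(x, y) \<in> X \<times> X. x \<noteq> y})"
  have fin: "finite S"
    unfolding S_def using assms by (auto intro: finite_subset[OF _ finite_cartesian_product])
  have pos: "Min S > 0" using fin by (subst Min_gr_iff) (auto simp: S_def)
  show thesis
  proof (rule that[of "Min S / 3"])
    show "Min S / 3 \<le> 1" using Min_le[OF fin, of 3] by (simp add: S_def)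
    fix x y assume xy: "x \<in> X" "y \<in> X" "x \<noteq> y"
    then have le: "Min S \<le> dist x y" using fin by (intro Min_le) (auto simp: S_def)
    show "cball x (Min S / 3) \<inter> cball y (Min S / 3) = {}"
    proof (rule ccontr)
      assume "\<not> ?thesis"
      then obtain w where "dist x w \<le> Min S / 3" "dist y w \<le> Min S / 3" by auto
      then show False using le pos dist_triangle[of x y w] by (simp add: dist_commute)
    qed
  qed (use pos in simp)
qed

theorem proposition5p6:
  fixes E :: "(real ^ 2) set"
  assumes "bounded E"
    and "BV_extension_set lborel E"
    and "\<Omega>\<^sub>i \<in> components (- closure (density_one_points E))"
    and "\<Omega>\<^sub>j \<in> components (- closure (density_one_points E))"
    and "\<Omega>\<^sub>i \<noteq> \<Omega>\<^sub>j"
  shows "finite (frontier \<Omega>\<^sub>i \<inter> frontier \<Omega>\<^sub>j)"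
proof (rule ccontr)
  assume inf: "infinite (frontier \<Omega>\<^sub>i \<inter> frontier \<Omega>\<^sub>j)"
  define F where "F = closure (density_one_points E)"
  have E: "E \<in> sets borel" using assms(2) by (simp add: BV_extension_set_def)
  have bF: "bounded F"
    unfolding F_def using density_one_points_subset_closure[OF E] assms(1)
    by (meson bounded_closure bounded_subset)
  have cF: "closed F" by (simp add: F_def)
  have EF: "AE x in lborel. x \<in> E \<longrightarrow> x \<in> F"
    using AE_density_one_points[OF E assms(1)] closure_subset unfolding F_def
    by (auto elim!: eventually_mono)
  note comp = assms(3,4)[folded F_def]
  have fr: "frontier \<Omega>\<^sub>i \<subseteq> F" using frontier_of_components_closed_complement[OF cF comp(1)] .
  have "F \<union> \<Omega>\<^sub>i = F \<union> closure \<Omega>\<^sub>i"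
    using fr by (auto simp: closure_Un_frontier)
  then have cFA: "closed (F \<union> \<Omega>\<^sub>i)" using cF closed_Un[OF cF closed_closure] by metis
  have disj: "\<Omega>\<^sub>i \<inter> F = {}" "\<Omega>\<^sub>j \<inter> F = {}" "\<Omega>\<^sub>i \<inter> \<Omega>\<^sub>j = {}"
    using comp assms(5) in_components_subset components_nonoverlap by blast+
  have op: "open \<Omega>\<^sub>i" "open \<Omega>\<^sub>j" using comp cF open_components[of "- F"] by auto
  have con: "connected \<Omega>\<^sub>i" "connected \<Omega>\<^sub>j" using comp in_components_connected by auto
  obtain C where C: "C \<ge> 1" and MB: "mass_bound C E"
    using BV_extension_mass_bound[OF assms(2,1)] by blast
  define c0 where "c0 = pi / (64 * C ^ 3)"
  have c0: "c0 > 0" using C by (simp add: c0_def)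
  obtain N :: nat where N: "measure lborel E < real N * c0"
    using ex_less_of_nat_mult[OF c0] by blast
  \<comment> \<open>The two extra points only ensure that \<open>X\<close> has at least two elements.\<close>
  obtain X where X: "X \<subseteq> frontier \<Omega>\<^sub>i \<inter> frontier \<Omega>\<^sub>j" "finite X" "card X = N + 2"
    using infinite_arbitrarily_large[OF inf, of "N + 2"] by blast
  have X0: "X \<noteq> {}" using X(3) by auto
  obtain \<sigma> where \<sigma>: "0 < \<sigma>" "\<sigma> \<le> 1"
    "\<And>x y. x \<in> X \<Longrightarrow> y \<in> X \<Longrightarrow> x \<noteq> y \<Longrightarrow> cball x \<sigma> \<inter> cball y \<sigma> = {}"
    using finite_separation_radius[OF X(2)] by blast
  \<comment> \<open>This is the lower bound of \<open>local_mass_lower_bound\<close> at radius \<open>\<sigma> / 4\<close>, and \<open>\<rho>\<close> is chosen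
    such that the variation of the cut-off near \<open>X\<close> stays below it.\<close>
  define m where "m = pi / (16384 * C ^ 3) * (\<sigma> / 16) ^ 3"
  have m: "m > 0" using C \<sigma> by (simp add: m_def)
  define \<rho> where "\<rho> = min (\<sigma> / 4) (m / (8 * pi * real (card X)))"
  have cX: "8 * pi * real (card X) > 0" using X by simp
  have \<rho>: "0 < \<rho>" "\<rho> \<le> \<sigma> / 4" using \<sigma> m cX by (auto simp: \<rho>_def)
  have "\<rho> \<le> m / (8 * pi * real (card X))" by (simp add: \<rho>_def)
  then have \<rho>m: "8 * pi * real (card X) * \<rho> \<le> m" using cX by (simp only: pos_le_divide_eq mult.commute)
  have cardX: "card X \<ge> 2" and XA: "X \<subseteq> closure \<Omega>\<^sub>i" and XB: "X \<subseteq> closure \<Omega>\<^sub>j"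
    and \<rho>\<sigma>: "\<rho> \<le> \<sigma>"
    using X \<rho> \<sigma> by (auto simp: frontier_def)
  obtain L :: "real ^ 2 \<Rightarrow> complex \<Rightarrow> int" and Z where L: "\<forall>V. closed {z \<in> F - (\<Union>x\<in>X. ball x \<rho>). L z \<in> V}"
    and Z: "Z \<subseteq> F - (\<Union>x\<in>X. ball x \<sigma>)" "finite Z" "card Z = card X" "inj_on L Z"
    by (rule common_boundary_points_split_plane[OF cF cFA disj op(1) con(1) op(2) con(2) X(2)
        cardX XA XB \<rho>(1) \<rho>\<sigma> \<sigma>(3)])
  define U where "U z = {w \<in> F - (\<Union>x\<in>X. ball x \<rho>). L w \<in> {L z}}" for z
  have comp: "compact {w \<in> F - (\<Union>x\<in>X. ball x \<rho>). L w \<in> V}" for V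
    using L bF by (auto simp: compact_eq_bounded_closed intro: bounded_subset)
  have Um: "U z \<in> sets borel" for z unfolding U_def using comp borel_compact by blast
  have big: "c0 \<le> measure lborel (E \<inter> U z)" if z: "z \<in> Z" for z
    unfolding c0_def
  proof (rule piece_mass_lower_bound[OF MB C E assms(1) EF _ _ _ X(2) X0])
    show "compact (U z)" unfolding U_def by (rule comp)
    show "compact {w \<in> F - (\<Union>x\<in>X. ball x \<rho>). L w \<in> - {L z}}" by (rule comp)
    show "z \<in> U z"
    proof -
      have "ball x \<rho> \<subseteq> ball x \<sigma>" for x using \<rho> \<sigma> by auto
      then show ?thesis using z Z(1) unfolding U_def by blast
    qed
    show "z \<in> closure (density_one_points E)" using z Z(1) by (auto simp: F_def)
    show "\<sigma> \<le> dist x z" if "x \<in> X" for x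
    proof -
      have "z \<notin> ball x \<sigma>" using z Z(1) that by blast
      then show ?thesis by simp
    qed
  qed (use \<sigma> \<rho> \<rho>m in \<open>auto simp: U_def m_def\<close>)
  have finE: "E \<in> fmeasurable lborel"
    using emeasure_bounded_finite[OF assms(1)] E by (auto simp: fmeasurable_def)
  have "real (card Z) * c0 \<le> (\<Sum>z\<in>Z. measure lborel (E \<inter> U z))"
    using sum_mono[of Z "\<lambda>_. c0"] big by simp
  also have "\<dots> = measure lborel (\<Union>z\<in>Z. E \<inter> U z)"
  proof (rule measure_finite_Union[symmetric, OF Z(2)])
    show "disjoint_family_on (\<lambda>z. E \<inter> U z) Z"
      using Z(4) by (auto simp: disjoint_family_on_def U_def inj_on_def)
    show "emeasure lborel (E \<inter> U z) \<noteq> \<infinity>" for z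
      using emeasure_bounded_finite[OF bounded_Int[OF disjI1[OF assms(1)]], of "U z"] by simp
  qed (use E Um in auto)
  also have "\<dots> \<le> measure lborel E"
    using E Um Z(2) finE by (intro measure_mono_fmeasurable) auto
  finally have "real (card Z) * c0 \<le> measure lborel E" .
  moreover have "real N * c0 \<le> real (card Z) * c0"
    using Z(3) X(3) c0 by (intro mult_right_mono) auto
  ultimately show False using N by linarith
qed

end
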